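(* For every integer $r\ge 3$ and every graph $H_r\in\mathcal{H}_r$, $\mathrm{egd}(H_r)=r$.
   Context: All graphs are finite and simple. Notation: $[n]=\{1,\dots,n\}$; $X\succeq 0$ means $X$ is a real symmetric positive semidefinite matrix. Extreme Gram dimension: for a graph $G=([n],E)$, $\mathrm{egd}(G)$ is the smallest integer $r\ge 1$ such that for every $w\in\mathbb{R}^E$ the semidefinite program $\max\ \sum_{ij\in E}w_{ij}X_{ij}$ subject to $X_{ii}=1$ $(i\in[n])$, $X\succeq 0$ ($X$ an $n\times n$ symmetric matrix) has an optimal solution of rank at most $r$. The graph $H_3$ is obtained from the complete graph $K_4$ on nodes $v_1,v_2,v_3,v_{13}$ by subdividing the edge $\{v_1,v_2\}$ with a new node $v_{12}$ and the edge $\{v_2,v_3\}$ with a new node $v_{23}$. The class $\mathcal{H}_r$ ($r\ge 3$): a graph $H_r\in\mathcal{H}_r$ has node set $V=V_0\cup V_3\cup\dots\cup V_r$, where $V_0=\{v_{ij}:3\le i<j\le r\}$ and, for $i\in\{3,\dots,r\}$, $V_i=\{v_1,v_2,v_{12},v_i,v_{1i},v_{2i}\}$ (so there are $\binom{r+1}{2}$ nodes in total). Its edges are exactly the following. For each $i\in\{3,\dots,r\}$, a copy of $H_3$ on $V_i$, with index $i$ playing the role of index $3$, i.e., the edges $\{v_1,v_{12}\},\{v_{12},v_2\},\{v_2,v_{2i}\},\{v_{2i},v_i\},\{v_1,v_i\},\{v_1,v_{1i}\},\{v_2,v_{1i}\},\{v_i,v_{1i}\}$. For each $3\le i<j\le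 r$, the edges $\{v_i,v_{ij}\}$ and $\{v_j,v_{ij}\}$, as well as exactly one edge, chosen arbitrarily, from the set $\{\{v_i,v_j\},\{v_i,v_{1j}\},\{v_j,v_{1i}\},\{v_{1i},v_{1j}\}\}$. $\mathcal{H}_r$ consists of all graphs obtained through such choices. *)

theory Defs
  imports Complex_Main "Jordan_Normal_Form.DL_Rank"
begin

section \<open>Extreme Gram dimension\<close>

text \<open>
  A graph on n nodes is given by its edge set, a set of two-element subsets of {0..<n}; the node
  set [n] is shifted to {0..<n} to agree with the index range of the matrices of the library.
\<close>

definition psd_mat :: "nat \<Rightarrow> real mat \<Rightarrow> bool" where
  "psd_mat n X \<longleftrightarrow> X \<in> carrier_mat n n \<and> transpose_mat X = X \<and>
     (\<forall>x \<in> carrier_vec n. x \<bullet> (X *\<^sub>v x) \<ge> 0)"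

definition sdp_feasible :: "nat \<Rightarrow> real mat \<Rightarrow> bool" where
  "sdp_feasible n X \<longleftrightarrow> psd_mat n X \<and> (\<forall>i<n. X $$ (i, i) = 1)"

text \<open>
  Every edge contributes once, through its ordered representation (i, j) with i < j, so only the
  values w i j with i < j matter and these form an arbitrary vector indexed by the edges.
\<close>

definition sdp_value :: "nat \<Rightarrow> nat set set \<Rightarrow> (nat \<Rightarrow> nat \<Rightarrow> real) \<Rightarrow> real mat \<Rightarrow> real" where
  "sdp_value n E w X =
     (\<Sum>(i, j) \<in> {(i, j). i < j \<and> j < n \<and> {i, j} \<in> E}. w i j * X $$ (i, j))"

definition sdp_optimal :: "nat \<Rightarrow> nat set set \<Rightarrow> (nat \<Rightarrow> nat \<Rightarrow> real) \<Rightarrow> real mat \<Rightarrow> bool" where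
  "sdp_optimal n E w X \<longleftrightarrow> sdp_feasible n X \<and>
     (\<forall>Y. sdp_feasible n Y \<longrightarrow> sdp_value n E w Y \<le> sdp_value n E w X)"

definition egd :: "nat \<Rightarrow> nat set set \<Rightarrow> nat" where
  "egd n E = (LEAST r. r \<ge> 1 \<and> (\<forall>w. \<exists>X. sdp_optimal n E w X \<and> vec_space.rank n X \<le> r))"


section \<open>The graph classes\<close>

text \<open>\<open>N i\<close> is the node \<open>v\<^sub>i\<close>, and \<open>M i j\<close> is the node \<open>v\<^sub>i\<^sub>j\<close> (used with i < j only).\<close>

datatype node = N nat | M nat nat

definition H3_nodes :: "nat \<Rightarrow> node set" where
  "H3_nodes i = {N 1, N 2, M 1 2, N i, M 1 i, M 2 i}"

text \<open>
  The complete graph on \<open>v\<^sub>1, v\<^sub>2, v\<^sub>i, v\<^sub>1\<^sub>i\<close> with the edge \<open>v\<^sub>1v\<^sub>2\<close> subdivided by \<open>v\<^sub>1\<^sub>2\<close> and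
  the edge \<open>v\<^sub>2v\<^sub>i\<close> subdivided by \<open>v\<^sub>2\<^sub>i\<close>.
\<close>

definition H3_edges :: "nat \<Rightarrow> node set set" where
  "H3_edges i =
     {{N 1, M 1 2}, {M 1 2, N 2}, {N 2, M 2 i}, {M 2 i, N i},
      {N 1, N i}, {N 1, M 1 i}, {N 2, M 1 i}, {N i, M 1 i}}"

definition index_pairs :: "nat \<Rightarrow> (nat \<times> nat) set" where
  "index_pairs r = {(i, j). 3 \<le> i \<and> i < j \<and> j \<le> r}"

definition link_edges :: "nat \<Rightarrow> nat \<Rightarrow> node set set" where
  "link_edges i j = {{N i, N j}, {N i, M 1 j}, {N j, M 1 i}, {M 1 i, M 1 j}}"

definition H_nodes :: "nat \<Rightarrow> node set" where
  "H_nodes r = {M i j | i j. (i, j) \<in> index_pairs r} \<union> (\<Union>i \<in> {3..r}. H3_nodes i)"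

text \<open>The function \<open>c\<close> records the edge chosen for each pair i < j.\<close>

definition H_edges :: "nat \<Rightarrow> (nat \<Rightarrow> nat \<Rightarrow> node set) \<Rightarrow> node set set" where
  "H_edges r c = (\<Union>i \<in> {3..r}. H3_edges i) \<union>
     (\<Union>(i, j) \<in> index_pairs r. {{N i, M i j}, {N j, M i j}, c i j})"

definition H_class :: "nat \<Rightarrow> (node set \<times> node set set) set" where
  "H_class r = {(H_nodes r, H_edges r c) | c. \<forall>(i, j) \<in> index_pairs r. c i j \<in> link_edges i j}"

end

theory Submission
  imports Defs "Jordan_Normal_Form.DL_Rank_Submatrix" "HOL-Analysis.Function_Topology"
begin

text \<open>
  Upper bound. The graph has \<open>r (r + 1) / 2\<close> nodes. If the rank \<open>s\<close> of an optimal solution satisfies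
  \<open>s (s + 1) / 2 > n\<close>, then the Gram vectors can be deformed without changing the diagonal or the value
  until the rank drops (\<open>maximizer_rank_reduction\<close>). As the feasible set is compact, an optimal solution of
  rank at most \<open>r\<close> exists for every weight (\<open>low_rank_optimum_exists\<close>).

  Lower bound. By semidefinite duality, a weight whose optimal solutions have large rank comes from a
  nonnegative quadratic form (a stress) supported on the diagonal and the edges: the optimal solutions are
  then exactly the feasible matrices whose columns lie in its kernel, provided that there is one
  (\<open>edge_form_forces_rank\<close>). The stress is constructed together with unit vectors in dimension \<open>r\<close>, namely
  \<open>e\<^sub>i\<close> at \<open>v\<^sub>i\<close>, \<open>(e\<^sub>i - e\<^sub>j) / \<surd>2\<close> at the nodes \<open>v\<^sub>1\<^sub>2\<close>, \<open>v\<^sub>2\<^sub>j\<close> and \<open>v\<^sub>i\<^sub>j\<close> with \<open>i \<ge> 3\<close>, and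
  \<open>e\<^sub>1 + e\<^sub>2 + \<Sum>\<^sub>k A\<^sub>i\<^sub>k e\<^sub>k\<close>, normalized, at \<open>v\<^sub>1\<^sub>i\<close>. It is built from the linear relations of these vectors:
  the node \<open>v\<^sub>i\<^sub>j\<close> of degree two has a relation \<open>D\<^sub>i\<^sub>j\<close> with its neighbours \<open>v\<^sub>i\<close>, \<open>v\<^sub>j\<close>, and the node \<open>v\<^sub>1\<^sub>i\<close> has a
  relation \<open>L\<^sub>i\<close> with \<open>v\<^sub>1, v\<^sub>2\<close> and the \<open>v\<^sub>k\<close>. The stress is \<open>\<Sum> T\<^sub>i\<^sub>j L\<^sub>i L\<^sub>j\<close> plus positive multiples of the
  \<open>D\<^sub>i\<^sub>j\<^sup>2\<close>. Each \<open>D\<^sub>i\<^sub>j\<^sup>2\<close> has a negative coefficient at \<open>v\<^sub>i v\<^sub>j\<close>, and can cancel whatever positive coefficient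
  the other part has there.

  It remains to choose \<open>A\<close> and a positive definite \<open>T\<close> such that the first part has positive coefficients at
  all pairs that must be cancelled, and none at the other nonadjacent pairs. With \<open>B = T A\<close>, the coefficients
  are \<open>T\<close> at the pairs \<open>v\<^sub>1\<^sub>i v\<^sub>1\<^sub>j\<close>, \<open>- B\<close> at the pairs \<open>v\<^sub>1\<^sub>i v\<^sub>k\<close> and \<open>B\<^sup>T T\<^sup>-\<^sup>1 B\<close> at the pairs \<open>v\<^sub>k v\<^sub>l\<close>, up to
  normalization. So \<open>T\<close> and \<open>B\<close> are the identity, except that an edge chosen between \<open>v\<^sub>1\<^sub>i\<close> and \<open>v\<^sub>1\<^sub>j\<close> puts \<open>- \<epsilon>\<close>
  into \<open>T\<close>, and one chosen between \<open>v\<^sub>1\<^sub>i\<close> and \<open>v\<^sub>k\<close> puts \<open>\<epsilon>\<close> into \<open>B\<close>. Since \<open>T\<close> is an M-matrix, its inverse is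
  nonnegative, and a chosen edge of either kind makes \<open>B\<^sup>T T\<^sup>-\<^sup>1 B\<close> positive at its pair (\<open>NN_pos\<close>). If \<open>v\<^sub>i v\<^sub>j\<close>
  itself is chosen, nothing has to cancel.

  Finally, a feasible matrix whose columns are zeros of the stress has an identity submatrix at
  \<open>v\<^sub>1, \<dots>, v\<^sub>r\<close>, since the relations and the unit diagonal determine all their inner products
  (\<open>zero_Q_orthonormal\<close>).
\<close>

section \<open>Homogeneous and square linear systems\<close>

text \<open>
  Gaussian elimination, by induction on the equations: an equation with a nonzero coefficient at \<open>p\<close> is
  solved for the variable \<open>p\<close>, which is thereby removed together with that equation.
\<close>

lemma underdetermined_system_nontrivial:
  fixes a :: "'j \<Rightarrow> 'i \<Rightarrow> real"
  assumes "finite J" and "finite I" and "card J < card I"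
  shows "\<exists>x. (\<exists>i\<in>I. x i \<noteq> 0) \<and> (\<forall>j\<in>J. (\<Sum>i\<in>I. a j i * x i) = 0)"
  using assms
proof (induction J arbitrary: a I rule: finite_induct)
  case empty
  then obtain i where "i \<in> I" by fastforce
  then show ?case by (intro exI[of _ "\<lambda>_. 1"]) auto
next
  case (insert k J)
  show ?case
  proof (cases "\<forall>i\<in>I. a k i = 0")
    case True
    have "card J < card I" using insert by simp
    then obtain x where "\<exists>i\<in>I. x i \<noteq> 0" "\<forall>j\<in>J. (\<Sum>i\<in>I. a j i * x i) = 0"
      using insert.IH[of I a] insert.prems by blast
    then show ?thesis using True by (intro exI[of _ x]) auto
  next
    case False
    then obtain p where p: "p \<in> I" "a k p \<noteq> 0" by blast
    let ?I = "I - {p}"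
    \<comment> \<open>The equation k is used to eliminate the coordinate p from the others.\<close>
    have "card J < card ?I" using insert p by simp
    then obtain x where x: "\<exists>i\<in>?I. x i \<noteq> 0"
      "\<And>j. j \<in> J \<Longrightarrow> (\<Sum>i\<in>?I. (a j i - a j p * (a k i / a k p)) * x i) = 0"
      using insert.IH[of ?I "\<lambda>j i. a j i - a j p * (a k i / a k p)"] insert.prems by auto
    define S where "S = (\<Sum>i\<in>?I. a k i / a k p * x i)"
    define z where "z = x(p := - S)"
    have split: "(\<Sum>i\<in>I. a j i * z i) = - a j p * S + (\<Sum>i\<in>?I. a j i * x i)" for j
      using p insert.prems by (simp add: sum.remove[of I p] z_def)
    have "(\<Sum>i\<in>I. a j i * z i) = 0" if "j \<in> J" for j
      using x(2)[OF that] unfolding split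
      by (simp add: S_def left_diff_distrib sum_subtractf sum_distrib_left mult.assoc sum_negf)
    moreover have "(\<Sum>i\<in>I. a k i * z i) = 0"
      unfolding split S_def using p by (simp add: sum_distrib_left sum_negf)
    moreover have "\<exists>i\<in>I. z i \<noteq> 0" using x(1) by (auto simp: z_def)
    ultimately show ?thesis by blast
  qed
qed

text \<open>
  The homogenized system, with one extra unknown \<open>None\<close> multiplying the right-hand side, is
  underdetermined. Injectivity forces that extra unknown to be nonzero in a nontrivial solution, and
  dividing by it solves the original system.
\<close>

lemma injective_system_solvable:
  fixes a :: "'i \<Rightarrow> 'i \<Rightarrow> real"
  assumes "finite I"
    and inj: "\<And>x. (\<And>i. i \<in> I \<Longrightarrow> (\<Sum>j\<in>I. a i j * x j) = 0) \<Longrightarrow> \<forall>j\<in>I. x j = 0"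
  shows "\<exists>x. \<forall>i\<in>I. (\<Sum>j\<in>I. a i j * x j) = b i"
proof -
  let ?K = "insert None (Some ` I)"
  have "card I < card ?K" using assms(1) by (simp add: card_image)
  then obtain z where z: "\<exists>k\<in>?K. z k \<noteq> 0"
    "\<And>i. i \<in> I \<Longrightarrow> (\<Sum>k\<in>?K. (case k of None \<Rightarrow> - b i | Some j \<Rightarrow> a i j) * z k) = 0"
    using underdetermined_system_nontrivial[of I ?K
        "\<lambda>i k. case k of None \<Rightarrow> - b i | Some j \<Rightarrow> a i j"] assms(1) by auto
  have eq: "(\<Sum>j\<in>I. a i j * z (Some j)) = b i * z None" if "i \<in> I" for i
    using z(2)[OF that] assms(1) by (simp add: sum.reindex)
  have "z None \<noteq> 0"
  proof
    assume "z None = 0"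
    then have "\<forall>j\<in>I. z (Some j) = 0" using inj[of "\<lambda>j. z (Some j)"] eq by simp
    then show False using z(1) \<open>z None = 0\<close> by auto
  qed
  then have "\<forall>i\<in>I. (\<Sum>j\<in>I. a i j * (z (Some j) / z None)) = b i"
    using eq by (simp flip: sum_divide_distrib)
  then show ?thesis by (intro exI)
qed

section \<open>Positive semidefinite forms and Gram representations\<close>

text \<open>
  Positive semidefiniteness of an array restricted to a finite index set. Working with functions on
  an arbitrary index set makes principal submatrices and Schur complements available without any
  renumbering.
\<close>

definition psd_on :: "'i set \<Rightarrow> ('i \<Rightarrow> 'i \<Rightarrow> real) \<Rightarrow> bool" where
  "psd_on I Y \<longleftrightarrow> (\<forall>i\<in>I. \<forall>j\<in>I. Y i j = Y j i) \<and>
     (\<forall>x. 0 \<le> (\<Sum>i\<in>I. \<Sum>j\<in>I. x i * Y i j * x j))"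

lemma psd_on_sym: "psd_on I Y \<Longrightarrow> i \<in> I \<Longrightarrow> j \<in> I \<Longrightarrow> Y i j = Y j i"
  by (simp add: psd_on_def)

lemma psd_on_nonneg: "psd_on I Y \<Longrightarrow> 0 \<le> (\<Sum>i\<in>I. \<Sum>j\<in>I. x i * Y i j * x j)"
  by (simp add: psd_on_def)

lemma form_insert:
  fixes Y :: "'i \<Rightarrow> 'i \<Rightarrow> real" and x :: "'i \<Rightarrow> real"
  assumes "finite I" and "a \<notin> I" and sym: "\<And>i. i \<in> I \<Longrightarrow> Y i a = Y a i"
  shows "(\<Sum>i\<in>insert a I. \<Sum>j\<in>insert a I. x i * Y i j * x j) =
    Y a a * (x a)\<^sup>2 + 2 * x a * (\<Sum>i\<in>I. Y a i * x i) + (\<Sum>i\<in>I. \<Sum>j\<in>I. x i * Y i j * x j)"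
proof -
  have 1: "(\<Sum>i\<in>I. x i * Y i a * x a) = x a * (\<Sum>i\<in>I. Y a i * x i)"
    using sym by (simp add: sum_distrib_left mult_ac)
  have 2: "(\<Sum>j\<in>I. x a * Y a j * x j) = x a * (\<Sum>i\<in>I. Y a i * x i)"
    by (simp add: sum_distrib_left mult_ac)
  have "(\<Sum>i\<in>insert a I. \<Sum>j\<in>insert a I. x i * Y i j * x j) =
    x a * Y a a * x a + (\<Sum>j\<in>I. x a * Y a j * x j) + ((\<Sum>i\<in>I. x i * Y i a * x a)
      + (\<Sum>i\<in>I. \<Sum>j\<in>I. x i * Y i j * x j))"
    using assms(1,2) by (simp add: sum.distrib)
  then show ?thesis unfolding 1 2 by (simp add: power2_eq_square)
qed

lemma psd_on_subset:
  assumes "finite I" and "J \<subseteq> I" and "psd_on I Y"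
  shows "psd_on J Y"
  unfolding psd_on_def
proof (intro conjI ballI allI)
  fix i j assume "i \<in> J" "j \<in> J"
  then show "Y i j = Y j i" using assms by (auto simp: psd_on_def)
next
  fix x :: "'a \<Rightarrow> real"
  let ?x = "\<lambda>i. if i \<in> J then x i else 0"
  have "0 \<le> (\<Sum>i\<in>I. \<Sum>j\<in>I. ?x i * Y i j * ?x j)" by (rule psd_on_nonneg[OF assms(3)])
  also have "\<dots> = (\<Sum>i\<in>J. \<Sum>j\<in>I. ?x i * Y i j * ?x j)"
    by (rule sum.mono_neutral_right) (use assms in auto)
  also have "\<dots> = (\<Sum>i\<in>J. \<Sum>j\<in>J. ?x i * Y i j * ?x j)"
    by (intro sum.cong refl sum.mono_neutral_right) (use assms in auto)
  also have "\<dots> = (\<Sum>i\<in>J. \<Sum>j\<in>J. x i * Y i j * x j)" by (intro sum.cong refl) auto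
  finally show "0 \<le> (\<Sum>i\<in>J. \<Sum>j\<in>J. x i * Y i j * x j)" .
qed

lemma psd_on_diag_nonneg:
  assumes "psd_on I Y" and "finite I" and "i \<in> I"
  shows "0 \<le> Y i i"
proof -
  have "psd_on {i} Y" using psd_on_subset[of I "{i}"] assms by simp
  then have "0 \<le> (\<Sum>k\<in>{i}. \<Sum>l\<in>{i}. x k * Y k l * x l)" for x :: "'a \<Rightarrow> real"
    by (rule psd_on_nonneg)
  from this[of "\<lambda>_. 1"] show ?thesis by simp
qed

text \<open>
  Nonnegativity of a \<open>2 \<times> 2\<close> principal form; besides the bound on entries it shows that a zero on the
  diagonal annihilates its whole row.
\<close>

lemma psd_on_minor:
  assumes "psd_on I Y" and "finite I" and "i \<in> I" and "j \<in> I"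
  shows "(Y i j)\<^sup>2 \<le> Y i i * Y j j"
proof (cases "i = j")
  case True
  then show ?thesis by (simp add: power2_eq_square)
next
  case False
  have psd: "psd_on {i, j} Y" using psd_on_subset[of I "{i, j}"] assms by simp
  have q: "0 \<le> Y i i * u\<^sup>2 + 2 * u * v * Y i j + Y j j * v\<^sup>2" for u v
  proof -
    define x where "x = (\<lambda>k. if k = i then u else v)"
    have "0 \<le> (\<Sum>k\<in>insert i {j}. \<Sum>l\<in>insert i {j}. x k * Y k l * x l)"
      by (rule psd_on_nonneg[OF psd])
    also have "\<dots> = Y i i * u\<^sup>2 + 2 * u * v * Y i j + Y j j * v\<^sup>2"
    proof (subst form_insert)
      show "Y k i = Y i k" if "k \<in> {j}" for k using psd_on_sym[OF psd] that by blast
    qed (use False in \<open>auto simp: x_def power2_eq_square\<close>)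
    finally show ?thesis .
  qed
  have d: "0 \<le> Y i i" "0 \<le> Y j j" using psd_on_diag_nonneg[OF assms(1,2)] assms(3,4) by auto
  show ?thesis
  proof (cases "Y i i = 0")
    case True
    have "Y i j = 0"
    proof (rule ccontr)
      assume n: "Y i j \<noteq> 0"
      have "0 \<le> 2 * (- (Y j j + 1) / (2 * Y i j)) * Y i j + Y j j"
        using q[of "- (Y j j + 1) / (2 * Y i j)" 1] True by simp
      also have "\<dots> = -1" using n by (simp add: field_simps)
      finally show False by simp
    qed
    then show ?thesis using True by simp
  next
    case f: False
    have "0 \<le> Y i i * (Y i i * Y j j - (Y i j)\<^sup>2)"
      using q[of "- Y i j" "Y i i"] by (simp add: power2_eq_square algebra_simps)
    then show ?thesis using f d by (simp add: zero_le_mult_iff)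
  qed
qed

text \<open>
  Inner products of the columns \<open>\<lambda>k. g k i\<close> of an \<open>s\<close>-row array, so \<open>s\<close> bounds the rank. The first index
  is the coordinate, which lets \<open>g k\<close> be read as a vector indexed by the nodes.
\<close>

definition gram :: "nat \<Rightarrow> (nat \<Rightarrow> 'i \<Rightarrow> real) \<Rightarrow> 'i \<Rightarrow> 'i \<Rightarrow> real" where
  "gram s g i j = (\<Sum>k<s. g k i * g k j)"

lemma gram_sym: "gram s g i j = gram s g j i"
  by (simp add: gram_def mult.commute)

lemma form_gram:
  "(\<Sum>i\<in>I. \<Sum>j\<in>I. x i * gram s g i j * x j) = (\<Sum>k<s. (\<Sum>i\<in>I. g k i * x i)\<^sup>2)"
proof -
  have "(\<Sum>i\<in>I. \<Sum>j\<in>I. x i * gram s g i j * x j) =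
    (\<Sum>i\<in>I. \<Sum>j\<in>I. \<Sum>k<s. (g k i * x i) * (g k j * x j))"
    by (simp add: gram_def sum_distrib_left sum_distrib_right mult_ac)
  also have "\<dots> = (\<Sum>i\<in>I. \<Sum>k<s. \<Sum>j\<in>I. (g k i * x i) * (g k j * x j))"
    by (intro sum.cong refl) (rule sum.swap)
  also have "\<dots> = (\<Sum>k<s. \<Sum>i\<in>I. \<Sum>j\<in>I. (g k i * x i) * (g k j * x j))" by (rule sum.swap)
  finally show ?thesis by (simp add: power2_eq_square sum_product)
qed

lemma psd_on_gram: "psd_on I (gram s g)"
  unfolding psd_on_def form_gram by (auto simp: gram_sym intro: sum_nonneg)

text \<open>
  The form of the Schur complement at \<open>x\<close> is the original form at the extension of \<open>x\<close> which minimizes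
  over the coordinate \<open>a\<close>. If \<open>Y a a = 0\<close>, division by zero makes the subtracted term vanish, and the
  statement degenerates to passing to a principal submatrix.
\<close>

lemma psd_on_schur:
  assumes "finite I" and "a \<notin> I" and psd: "psd_on (insert a I) Y"
  shows "psd_on I (\<lambda>i j. Y i j - Y i a * Y a j / Y a a)"
  unfolding psd_on_def
proof (intro conjI ballI allI)
  fix i j assume "i \<in> I" "j \<in> I"
  then have "Y j i = Y i j" "Y j a = Y a j" "Y a i = Y i a" using psd_on_sym[OF psd] by blast+
  then show "Y i j - Y i a * Y a j / Y a a = Y j i - Y j a * Y a i / Y a a" by simp
next
  fix x :: "'a \<Rightarrow> real"
  define L where "L = (\<Sum>i\<in>I. Y a i * x i)"
  \<comment> \<open>The minimizer of the form over the coordinate a.\<close>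
  define x' where "x' = x(a := - L / Y a a)"
  have ne: "i \<noteq> a" if "i \<in> I" for i using that assms(2) by auto
  have sum1: "(\<Sum>i\<in>I. Y a i * x' i) = L"
    unfolding L_def by (intro sum.cong refl) (auto simp: ne x'_def)
  have sum2: "(\<Sum>i\<in>I. \<Sum>j\<in>I. x' i * Y i j * x' j) = (\<Sum>i\<in>I. \<Sum>j\<in>I. x i * Y i j * x j)"
    by (intro sum.cong refl) (auto simp: ne x'_def)
  have "0 \<le> (\<Sum>i\<in>insert a I. \<Sum>j\<in>insert a I. x' i * Y i j * x' j)"
    by (rule psd_on_nonneg[OF psd])
  also have "\<dots> = Y a a * (x' a)\<^sup>2 + 2 * x' a * L + (\<Sum>i\<in>I. \<Sum>j\<in>I. x i * Y i j * x j)"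
    using form_insert[of I a Y x'] assms(1,2) psd_on_sym[OF psd] unfolding sum1 sum2 by blast
  also have "\<dots> = (\<Sum>i\<in>I. \<Sum>j\<in>I. x i * Y i j * x j) - L\<^sup>2 / Y a a"
    by (cases "Y a a = 0") (auto simp: x'_def power2_eq_square field_simps)
  also have "L\<^sup>2 / Y a a = (\<Sum>i\<in>I. \<Sum>j\<in>I. x i * (Y i a * Y a j / Y a a) * x j)"
  proof -
    have "L\<^sup>2 = (\<Sum>i\<in>I. \<Sum>j\<in>I. (Y a i * x i) * (Y a j * x j))"
      by (simp add: L_def power2_eq_square sum_product)
    also have "\<dots> = (\<Sum>i\<in>I. \<Sum>j\<in>I. (Y i a * x i) * (Y a j * x j))"
      by (intro sum.cong refl arg_cong2[of _ _ _ _ "(*)"]) (use psd_on_sym[OF psd] in blast)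
    finally show ?thesis by (simp add: sum_divide_distrib mult_ac)
  qed
  finally show "0 \<le> (\<Sum>i\<in>I. \<Sum>j\<in>I. x i * (Y i j - Y i a * Y a j / Y a a) * x j)"
    by (simp add: algebra_simps sum_subtractf)
qed

text \<open>
  Cholesky factorization: each step splits off the rank-one part spanned by the row of \<open>a\<close> and
  continues with the Schur complement.
\<close>

lemma psd_on_imp_gram:
  assumes "finite I" and "psd_on I Y"
  shows "\<exists>g. \<forall>i\<in>I. \<forall>j\<in>I. Y i j = gram (card I) g i j"
  using assms
proof (induction I arbitrary: Y rule: finite_induct)
  case empty
  then show ?case by simp
next
  case (insert a I)
  note psd = \<open>psd_on (insert a I) Y\<close>
  obtain g where g: "\<And>i j. i \<in> I \<Longrightarrow> j \<in> I \<Longrightarrow>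
      Y i j - Y i a * Y a j / Y a a = gram (card I) g i j"
    using insert.IH[OF psd_on_schur[OF insert.hyps psd]] by blast
  define h where "h = (\<lambda>k i. if k = card I then Y i a / sqrt (Y a a) else if i = a then 0 else g k i)"
  have d: "0 \<le> Y a a" using psd_on_diag_nonneg[OF psd] insert.hyps by simp
  have zero: "Y a i = 0" if "Y a a = 0" "i \<in> insert a I" for i
    using psd_on_minor[OF psd, of a i] that insert.hyps by simp
  have sq: "sqrt (Y a a) * sqrt (Y a a) = Y a a" using d by simp
  have top: "gram (Suc (card I)) h i j = Y i a * Y j a / Y a a + gram (card I) h i j" for i j
    by (simp add: gram_def h_def sq abs_of_nonneg[OF d])
  have "Y i j = gram (Suc (card I)) h i j" if "i \<in> insert a I" "j \<in> insert a I" for i j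
  proof (cases "i = a \<or> j = a")
    case True
    then have "gram (card I) h i j = 0" by (auto simp: gram_def h_def)
    moreover have "Y i a * Y j a / Y a a = Y i j"
      using True zero[of i] zero[of j] psd_on_sym[OF psd, of i a] psd_on_sym[OF psd, of j a] that
      by auto
    ultimately show ?thesis using top by simp
  next
    case False
    then have ij: "i \<in> I" "j \<in> I" using that by auto
    have "gram (card I) h i j = gram (card I) g i j"
      using False by (simp add: gram_def h_def)
    then show ?thesis
      using g[OF ij] top psd_on_sym[OF psd, of j a] that by simp
  qed
  then show ?case using insert.hyps by auto
qed

text \<open>
  A kernel vector with a nonzero entry at \<open>k\<close> expresses the row of \<open>k\<close> through the other rows. So the
  other vectors of a Gram representation, which fit into one dimension less, determine the vector of
  \<open>k\<close> as a linear combination.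
\<close>

lemma singular_psd_on_imp_gram:
  assumes "finite I" and psd: "psd_on I Y" and "k \<in> I" and "z k \<noteq> 0"
    and ker: "\<And>i. i \<in> I \<Longrightarrow> (\<Sum>j\<in>I. Y i j * z j) = 0"
  shows "\<exists>g. \<forall>i\<in>I. \<forall>j\<in>I. Y i j = gram (card I - 1) g i j"
proof -
  let ?I = "I - {k}"
  have fin: "finite ?I" using assms by simp
  have "psd_on ?I Y" using psd_on_subset[OF assms(1) _ psd] by blast
  then obtain g where g: "\<And>i j. i \<in> ?I \<Longrightarrow> j \<in> ?I \<Longrightarrow> Y i j = gram (card ?I) g i j"
    using psd_on_imp_gram[OF fin] by blast
  define c where "c = (\<lambda>j. - z j / z k)"
  have row: "Y i k = (\<Sum>j\<in>?I. Y i j * c j)" if "i \<in> I" for i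
  proof -
    have "Y i k * z k + (\<Sum>j\<in>?I. Y i j * z j) = 0"
      using ker[OF that] assms(1,3) by (simp add: sum.remove)
    then have "Y i k = - (\<Sum>j\<in>?I. Y i j * z j) / z k" using assms(4) by (simp add: field_simps)
    also have "\<dots> = (\<Sum>j\<in>?I. Y i j * c j)" by (simp add: c_def sum_divide_distrib sum_negf)
    finally show ?thesis .
  qed
  define h where "h = (\<lambda>l. (g l)(k := (\<Sum>j\<in>?I. g l j * c j)))"
  have offk: "gram (card ?I) h i j = gram (card ?I) g i j" if "i \<noteq> k" "j \<noteq> k" for i j
    using that by (simp add: gram_def h_def)
  have hk: "gram (card ?I) h i k = (\<Sum>j\<in>?I. gram (card ?I) h i j * c j)" for i
  proof -
    have "gram (card ?I) h i k = (\<Sum>l<card ?I. \<Sum>j\<in>?I. h l i * h l j * c j)"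
      unfolding gram_def
      by (intro sum.cong refl) (auto simp: h_def sum_distrib_left mult.assoc intro!: sum.cong)
    also have "\<dots> = (\<Sum>j\<in>?I. \<Sum>l<card ?I. h l i * h l j * c j)" by (rule sum.swap)
    finally show ?thesis by (simp add: gram_def sum_distrib_right)
  qed
  have 1: "Y i j = gram (card ?I) h i j" if "i \<in> ?I" "j \<in> ?I" for i j
    using g[OF that] offk that by simp
  have 2: "Y i k = gram (card ?I) h i k" if "i \<in> ?I" for i
    unfolding hk using row[of i] that 1 by simp
  have 3: "Y k i = gram (card ?I) h k i" if "i \<in> ?I" for i
    using 2[OF that] gram_sym psd_on_sym[OF psd, of k i] that assms(3) by (metis DiffD1)
  have "Y k k = gram (card ?I) h k k"
    unfolding hk using row[of k] 3 assms(3) by simp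
  then have "Y i j = gram (card ?I) h i j" if "i \<in> I" "j \<in> I" for i j
    using 1 2 3 that by (cases "i = k"; cases "j = k") auto
  then show ?thesis using assms(1,3) by auto
qed

section \<open>The boundary of the semidefinite cone\<close>

lemma abs_form_le:
  fixes R :: "'i \<Rightarrow> 'i \<Rightarrow> real"
  assumes "finite I"
  shows "\<bar>\<Sum>k\<in>I. \<Sum>l\<in>I. z k * R k l * z l\<bar> \<le> (\<Sum>k\<in>I. \<Sum>l\<in>I. \<bar>R k l\<bar>) * (\<Sum>k\<in>I. (z k)\<^sup>2)"
proof -
  have le: "\<bar>z k * R k l * z l\<bar> \<le> \<bar>R k l\<bar> * (\<Sum>k\<in>I. (z k)\<^sup>2)" if "k \<in> I" "l \<in> I" for k l
  proof -
    have m: "(z i)\<^sup>2 \<le> (\<Sum>k\<in>I. (z k)\<^sup>2)" if "i \<in> I" for i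
      using member_le_sum[of i I "\<lambda>k. (z k)\<^sup>2"] that assms by simp
    have "0 \<le> (\<bar>z k\<bar> - \<bar>z l\<bar>)\<^sup>2" by simp
    then have "2 * (\<bar>z k\<bar> * \<bar>z l\<bar>) \<le> (z k)\<^sup>2 + (z l)\<^sup>2" by (simp add: power2_diff)
    then have "\<bar>z k\<bar> * \<bar>z l\<bar> \<le> (\<Sum>k\<in>I. (z k)\<^sup>2)" using m[OF that(1)] m[OF that(2)] by simp
    then have "\<bar>R k l\<bar> * (\<bar>z k\<bar> * \<bar>z l\<bar>) \<le> \<bar>R k l\<bar> * (\<Sum>k\<in>I. (z k)\<^sup>2)" by (rule mult_left_mono) simp
    then show ?thesis by (simp add: abs_mult mult_ac)
  qed
  have "\<bar>\<Sum>k\<in>I. \<Sum>l\<in>I. z k * R k l * z l\<bar> \<le> (\<Sum>k\<in>I. \<Sum>l\<in>I. \<bar>z k * R k l * z l\<bar>)"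
    by (rule order_trans[OF sum_abs]) (intro sum_mono sum_abs)
  also have "\<dots> \<le> (\<Sum>k\<in>I. \<Sum>l\<in>I. \<bar>R k l\<bar> * (\<Sum>k\<in>I. (z k)\<^sup>2))"
    by (intro sum_mono le)
  finally show ?thesis by (simp add: sum_distrib_right)
qed

text \<open>
  Where a semidefinite form vanishes, it attains its minimum; in a Gram representation the form is a
  sum of squares, so all of them vanish.
\<close>

lemma psd_on_kernel:
  assumes "finite I" and "psd_on I Y" and "(\<Sum>i\<in>I. \<Sum>j\<in>I. z i * Y i j * z j) = 0" and "i \<in> I"
  shows "(\<Sum>j\<in>I. Y i j * z j) = 0"
proof -
  let ?s = "card I"
  obtain g where g: "\<And>i j. i \<in> I \<Longrightarrow> j \<in> I \<Longrightarrow> Y i j = gram ?s g i j"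
    using psd_on_imp_gram[OF assms(1,2)] by blast
  have "(\<Sum>i\<in>I. \<Sum>j\<in>I. z i * Y i j * z j) = (\<Sum>i\<in>I. \<Sum>j\<in>I. z i * gram ?s g i j * z j)"
    by (intro sum.cong refl) (simp add: g)
  then have "(\<Sum>k<?s. (\<Sum>i\<in>I. g k i * z i)\<^sup>2) = 0" using assms(3) unfolding form_gram by simp
  then have zero: "(\<Sum>i\<in>I. g k i * z i) = 0" if "k < ?s" for k
    using that by (simp add: sum_nonneg_eq_0_iff)
  have "(\<Sum>j\<in>I. Y i j * z j) = (\<Sum>j\<in>I. \<Sum>k<?s. g k i * (g k j * z j))"
    by (intro sum.cong refl) (simp add: g[OF assms(4)] gram_def sum_distrib_right mult.assoc)
  also have "\<dots> = (\<Sum>k<?s. \<Sum>j\<in>I. g k i * (g k j * z j))" by (rule sum.swap)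
  also have "\<dots> = 0" using zero by (simp flip: sum_distrib_left)
  finally show ?thesis .
qed

lemma compact_cube: "compact {y :: 'i \<Rightarrow> real. \<forall>i. \<bar>y i\<bar> \<le> 1}"
proof -
  have eq: "{y :: 'i \<Rightarrow> real. \<forall>i. \<bar>y i\<bar> \<le> 1} = PiE UNIV (\<lambda>_. {-1..1})"
    by (auto simp: PiE_def Pi_def abs_le_iff minus_le_iff)
  have "compactin (product_topology (\<lambda>_. euclidean) UNIV) (PiE UNIV (\<lambda>_::'i. {-1..1::real}))"
    unfolding compactin_PiE by simp
  then show ?thesis
    unfolding eq by (simp add: euclidean_product_topology)
qed

lemma continuous_on_form:
  fixes R :: "'i \<Rightarrow> 'i \<Rightarrow> real"
  shows "continuous_on A (\<lambda>z. \<Sum>k\<in>I. \<Sum>l\<in>I. z k * R k l * z l)"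
  by (intro continuous_intros continuous_on_subset[OF continuous_on_product_coordinates subset_UNIV])

text \<open>
  The minimum of a quadratic form on the unit sphere, stated for all vectors by homogeneity. The
  vectors are forced to vanish off \<open>I\<close>, so that the sphere is a closed subset of a compact cube.
\<close>

lemma form_min_on_sphere:
  fixes R :: "'i \<Rightarrow> 'i \<Rightarrow> real"
  assumes "finite I" and "I \<noteq> {}"
  obtains z where "(\<Sum>k\<in>I. (z k)\<^sup>2) = 1"
    and "\<And>x. (\<Sum>k\<in>I. \<Sum>l\<in>I. z k * R k l * z l) * (\<Sum>k\<in>I. (x k)\<^sup>2) \<le> (\<Sum>k\<in>I. \<Sum>l\<in>I. x k * R k l * x l)"
proof -
  let ?q = "\<lambda>z. \<Sum>k\<in>I. \<Sum>l\<in>I. z k * R k l * z l"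
  define S where "S = {z :: 'i \<Rightarrow> real. (\<Sum>k\<in>I. (z k)\<^sup>2) = 1 \<and> (\<forall>k. k \<notin> I \<longrightarrow> z k = 0)}"
  have coord: "continuous_on UNIV (\<lambda>z :: 'i \<Rightarrow> real. z k)" for k
    by (rule continuous_on_product_coordinates)
  have "closed S" unfolding S_def
    by (intro closed_Collect_conj closed_Collect_all closed_Collect_imp closed_Collect_eq
        continuous_intros coord) auto
  moreover have "S \<subseteq> {y. \<forall>i. \<bar>y i\<bar> \<le> 1}"
  proof clarify
    fix z i assume z: "z \<in> S"
    show "\<bar>z i\<bar> \<le> 1"
    proof (cases "i \<in> I")
      case True
      then have "(z i)\<^sup>2 \<le> 1"
        using member_le_sum[of i I "\<lambda>k. (z k)\<^sup>2"] z assms(1) by (simp add: S_def)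
      then show ?thesis by (simp add: abs_le_square_iff[of _ 1, simplified])
    qed (use z in \<open>simp add: S_def\<close>)
  qed
  ultimately have "compact S"
    using compact_Int_closed[OF compact_cube, of S] by (simp add: Int_absorb1)
  moreover have "S \<noteq> {}"
  proof -
    obtain i where "i \<in> I" using assms(2) by blast
    then have "(\<lambda>k. if k = i then 1 else 0) \<in> S"
      using assms(1) by (auto simp: S_def if_distrib[of "\<lambda>x. x\<^sup>2"] cong: if_cong)
    then show ?thesis by blast
  qed
  ultimately obtain z where z: "z \<in> S" and min: "\<And>x. x \<in> S \<Longrightarrow> ?q z \<le> ?q x"
    using continuous_attains_inf[of S ?q] continuous_on_form by blast
  have "?q z * (\<Sum>k\<in>I. (x k)\<^sup>2) \<le> ?q x" for x
  proof (cases "(\<Sum>k\<in>I. (x k)\<^sup>2) = 0")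
    case True
    then have "x k = 0" if "k \<in> I" for k using that assms(1) by (simp add: sum_nonneg_eq_0_iff)
    then show ?thesis using True by simp
  next
    case False
    define N where "N = (\<Sum>k\<in>I. (x k)\<^sup>2)"
    have N: "N > 0" using False unfolding N_def by (simp add: less_le sum_nonneg)
    let ?y = "\<lambda>k. if k \<in> I then x k / sqrt N else 0"
    have "(\<Sum>k\<in>I. (?y k)\<^sup>2) = (\<Sum>k\<in>I. (x k)\<^sup>2 / N)"
      by (intro sum.cong refl) (use N in \<open>simp add: power_divide\<close>)
    then have "?y \<in> S"
      using N by (simp add: S_def N_def flip: sum_divide_distrib)
    then have "?q z \<le> ?q ?y" by (rule min)
    also have "?q ?y = (\<Sum>k\<in>I. \<Sum>l\<in>I. x k * R k l * x l / N)"
      by (intro sum.cong refl) (use N in \<open>simp add: field_simps\<close>)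
    also have "\<dots> = ?q x / N" by (simp add: sum_divide_distrib)
    finally show ?thesis using N by (simp add: field_simps N_def)
  qed
  then show thesis using that[of z] z by (simp add: S_def)
qed

lemma form_identity_plus:
  fixes R :: "'i \<Rightarrow> 'i \<Rightarrow> real"
  assumes "finite I"
  shows "(\<Sum>k\<in>I. \<Sum>l\<in>I. x k * ((if k = l then 1 else 0) + t * R k l) * x l) =
    (\<Sum>k\<in>I. (x k)\<^sup>2) + t * (\<Sum>k\<in>I. \<Sum>l\<in>I. x k * R k l * x l)"
proof -
  have "(\<Sum>k\<in>I. \<Sum>l\<in>I. x k * ((if k = l then 1 else 0) + t * R k l) * x l) =
    (\<Sum>k\<in>I. \<Sum>l\<in>I. (if k = l then x k * x l else 0) + t * (x k * R k l * x l))"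
    by (intro sum.cong refl) (simp add: algebra_simps)
  then show ?thesis
    using assms by (simp add: sum.distrib power2_eq_square sum_distrib_left)
qed

text \<open>
  Moving from the identity in a symmetric direction \<open>R\<close> that is not positive semidefinite, one leaves the
  semidefinite cone at \<open>t = - 1 / \<mu>\<close>, where \<open>\<mu> < 0\<close> is the smallest eigenvalue of \<open>R\<close>. The boundary point
  is singular and hence has a Gram representation in one dimension less.
\<close>

lemma identity_plus_boundary:
  fixes R :: "'i \<Rightarrow> 'i \<Rightarrow> real"
  assumes "finite I" and sym: "\<And>k l. R k l = R l k"
    and neg: "(\<Sum>k\<in>I. \<Sum>l\<in>I. x k * R k l * x l) < 0"
  obtains t g where "\<And>k l. k \<in> I \<Longrightarrow> l \<in> I \<Longrightarrow>
    (if k = l then 1 else 0) + t * R k l = gram (card I - 1) g k l"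
proof -
  let ?q = "\<lambda>z. \<Sum>k\<in>I. \<Sum>l\<in>I. z k * R k l * z l"
  have "I \<noteq> {}" using neg by auto
  then obtain z where z: "(\<Sum>k\<in>I. (z k)\<^sup>2) = 1"
    and min: "\<And>x. ?q z * (\<Sum>k\<in>I. (x k)\<^sup>2) \<le> ?q x"
    using form_min_on_sphere[OF assms(1), of R] by blast
  have "?q z < 0"
  proof (rule ccontr)
    assume "\<not> ?q z < 0"
    then have "0 \<le> ?q z * (\<Sum>k\<in>I. (x k)\<^sup>2)" by (simp add: sum_nonneg)
    then show False using min[of x] neg by simp
  qed
  define t where "t = - 1 / ?q z"
  have t: "t > 0" "t * ?q z = -1" using \<open>?q z < 0\<close> by (simp_all add: t_def)
  define G where "G = (\<lambda>k l. (if k = l then 1 else 0) + t * R k l)"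
  have form: "(\<Sum>k\<in>I. \<Sum>l\<in>I. x k * G k l * x l) = (\<Sum>k\<in>I. (x k)\<^sup>2) + t * ?q x" for x
    unfolding G_def by (rule form_identity_plus[OF assms(1)])
  have "0 \<le> (\<Sum>k\<in>I. \<Sum>l\<in>I. x k * G k l * x l)" for x
  proof -
    have "t * (?q z * (\<Sum>k\<in>I. (x k)\<^sup>2)) \<le> t * ?q x" using min[of x] t(1) by (intro mult_left_mono) auto
    then show ?thesis unfolding form using t(2) by (simp flip: mult.assoc)
  qed
  then have psd: "psd_on I G" unfolding psd_on_def using sym by (auto simp: G_def)
  have "(\<Sum>k\<in>I. \<Sum>l\<in>I. z k * G k l * z l) = 0" unfolding form using z t(2) by simp
  then have ker: "(\<Sum>l\<in>I. G k l * z l) = 0" if "k \<in> I" for k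
    using psd_on_kernel[OF assms(1) psd _ that] by blast
  obtain k where "k \<in> I" "z k \<noteq> 0"
  proof (rule ccontr)
    assume "\<not> thesis"
    then have "\<forall>k\<in>I. z k = 0" using that by blast
    then show False using z by simp
  qed
  then obtain g where "\<forall>k\<in>I. \<forall>l\<in>I. G k l = gram (card I - 1) g k l"
    using singular_psd_on_imp_gram[OF assms(1) psd _ _ ker] by blast
  then show thesis using that[of t g] by (simp add: G_def)
qed

section \<open>The semidefinite program in terms of arrays\<close>

definition elliptope :: "nat \<Rightarrow> (nat \<Rightarrow> nat \<Rightarrow> real) \<Rightarrow> bool" where
  "elliptope n Y \<longleftrightarrow> psd_on {..<n} Y \<and> (\<forall>i<n. Y i i = 1)"

definition edge_pairs :: "nat \<Rightarrow> nat set set \<Rightarrow> (nat \<times> nat) set" where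
  "edge_pairs n E = {(i, j). i < j \<and> j < n \<and> {i, j} \<in> E}"

definition edge_value :: "nat \<Rightarrow> nat set set \<Rightarrow> (nat \<Rightarrow> nat \<Rightarrow> real) \<Rightarrow> (nat \<Rightarrow> nat \<Rightarrow> real) \<Rightarrow> real" where
  "edge_value n E w Y = (\<Sum>(i, j) \<in> edge_pairs n E. w i j * Y i j)"

definition maximizes :: "nat \<Rightarrow> nat set set \<Rightarrow> (nat \<Rightarrow> nat \<Rightarrow> real) \<Rightarrow> (nat \<Rightarrow> nat \<Rightarrow> real) \<Rightarrow> bool" where
  "maximizes n E w Y \<longleftrightarrow> elliptope n Y \<and>
     (\<forall>Z. elliptope n Z \<longrightarrow> edge_value n E w Z \<le> edge_value n E w Y)"

lemma finite_edge_pairs [simp]: "finite (edge_pairs n E)"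
  by (rule finite_subset[of _ "{..<n} \<times> {..<n}"]) (auto simp: edge_pairs_def)

lemma edge_value_cong:
  "(\<And>i j. i < n \<Longrightarrow> j < n \<Longrightarrow> Y i j = Z i j) \<Longrightarrow> edge_value n E w Y = edge_value n E w Z"
  unfolding edge_value_def by (intro sum.cong refl) (auto simp: edge_pairs_def)

lemma elliptope_cong:
  assumes "\<And>i j. i < n \<Longrightarrow> j < n \<Longrightarrow> Y i j = Z i j"
  shows "elliptope n Y \<longleftrightarrow> elliptope n Z"
proof -
  have "(\<Sum>i<n. \<Sum>j<n. x i * Y i j * x j) = (\<Sum>i<n. \<Sum>j<n. x i * Z i j * x j)" for x
    by (intro sum.cong refl) (simp add: assms)
  then show ?thesis by (auto simp: elliptope_def psd_on_def assms)
qed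

lemma maximizes_cong:
  assumes "\<And>i j. i < n \<Longrightarrow> j < n \<Longrightarrow> Y i j = Z i j"
  shows "maximizes n E w Y \<longleftrightarrow> maximizes n E w Z"
  using edge_value_cong[of n Y Z E w, OF assms] elliptope_cong[of n Y Z, OF assms]
  by (simp add: maximizes_def)

lemma scalar_prod_mult_mat_vec:
  assumes "X \<in> carrier_mat n n" and "x \<in> carrier_vec n"
  shows "x \<bullet> (X *\<^sub>v x) = (\<Sum>i<n. \<Sum>j<n. x $ i * X $$ (i, j) * x $ j)"
  using assms
  by (simp add: scalar_prod_def sum_distrib_left mult.assoc lessThan_atLeast0)

lemma sdp_feasible_iff_elliptope:
  "sdp_feasible n X \<longleftrightarrow> X \<in> carrier_mat n n \<and> elliptope n (\<lambda>i j. X $$ (i, j))"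
proof (cases "X \<in> carrier_mat n n")
  case True
  have sym: "transpose_mat X = X \<longleftrightarrow> (\<forall>i\<in>{..<n}. \<forall>j\<in>{..<n}. X $$ (i, j) = X $$ (j, i))"
  proof
    assume eq: "transpose_mat X = X"
    show "\<forall>i\<in>{..<n}. \<forall>j\<in>{..<n}. X $$ (i, j) = X $$ (j, i)"
    proof clarify
      fix i j assume "i < n" "j < n"
      then have "transpose_mat X $$ (j, i) = X $$ (i, j)" using True by simp
      then show "X $$ (i, j) = X $$ (j, i)" unfolding eq by simp
    qed
  next
    assume "\<forall>i\<in>{..<n}. \<forall>j\<in>{..<n}. X $$ (i, j) = X $$ (j, i)"
    then show "transpose_mat X = X" using True by (intro eq_matI) auto
  qed
  have "(\<forall>x\<in>carrier_vec n. 0 \<le> x \<bullet> (X *\<^sub>v x)) \<longleftrightarrow>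
    (\<forall>x. 0 \<le> (\<Sum>i<n. \<Sum>j<n. x i * X $$ (i, j) * x j))"
  proof
    assume *: "\<forall>x\<in>carrier_vec n. 0 \<le> x \<bullet> (X *\<^sub>v x)"
    show "\<forall>x. 0 \<le> (\<Sum>i<n. \<Sum>j<n. x i * X $$ (i, j) * x j)"
    proof
      fix x :: "nat \<Rightarrow> real"
      have "0 \<le> vec n x \<bullet> (X *\<^sub>v vec n x)" using * by simp
      also have "\<dots> = (\<Sum>i<n. \<Sum>j<n. x i * X $$ (i, j) * x j)"
        by (subst scalar_prod_mult_mat_vec[OF True]) (auto intro!: sum.cong)
      finally show "0 \<le> (\<Sum>i<n. \<Sum>j<n. x i * X $$ (i, j) * x j)" .
    qed
  next
    assume "\<forall>x. 0 \<le> (\<Sum>i<n. \<Sum>j<n. x i * X $$ (i, j) * x j)"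
    then show "\<forall>x\<in>carrier_vec n. 0 \<le> x \<bullet> (X *\<^sub>v x)"
      by (simp add: scalar_prod_mult_mat_vec[OF True])
  qed
  then show ?thesis
    using True sym by (simp add: sdp_feasible_def psd_mat_def elliptope_def psd_on_def)
next
  case False
  then show ?thesis by (simp add: sdp_feasible_def psd_mat_def)
qed

lemma sdp_value_eq_edge_value: "sdp_value n E w X = edge_value n E w (\<lambda>i j. X $$ (i, j))"
  by (simp add: sdp_value_def edge_value_def edge_pairs_def)

lemma sdp_optimal_iff_maximizes:
  "sdp_optimal n E w X \<longleftrightarrow> X \<in> carrier_mat n n \<and> maximizes n E w (\<lambda>i j. X $$ (i, j))"
proof
  assume opt: "sdp_optimal n E w X"
  have "edge_value n E w Z \<le> edge_value n E w (\<lambda>i j. X $$ (i, j))" if Z: "elliptope n Z" for Z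
  proof -
    let ?Z = "mat n n (\<lambda>(i, j). Z i j)"
    have "elliptope n (\<lambda>i j. ?Z $$ (i, j))"
      using Z by (subst elliptope_cong[of n _ Z]) auto
    then have "sdp_value n E w ?Z \<le> sdp_value n E w X"
      using opt by (simp add: sdp_optimal_def sdp_feasible_iff_elliptope)
    moreover have "edge_value n E w (\<lambda>i j. ?Z $$ (i, j)) = edge_value n E w Z"
      by (rule edge_value_cong) simp
    ultimately show ?thesis by (simp add: sdp_value_eq_edge_value)
  qed
  then show "X \<in> carrier_mat n n \<and> maximizes n E w (\<lambda>i j. X $$ (i, j))"
    using opt by (simp add: sdp_optimal_def sdp_feasible_iff_elliptope maximizes_def)
qed (auto simp: sdp_optimal_def sdp_feasible_iff_elliptope maximizes_def sdp_value_eq_edge_value)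

lemma rank_gram_le: "vec_space.rank n (mat n n (\<lambda>(i, j). gram s g i j)) \<le> s"
proof (induction s)
  case 0
  have "mat n n (\<lambda>(i, j). gram 0 g i j) = (0\<^sub>m n n :: real mat)"
    by (intro eq_matI) (auto simp: gram_def)
  then show ?case using vec_space.rank_0I[where ?'a = real, of n n] by simp
next
  case (Suc s)
  let ?A = "mat n n (\<lambda>(i, j). gram s g i j)" and ?B = "mat n n (\<lambda>(i, j). g s i * g s j)"
  have "mat n n (\<lambda>(i, j). gram (Suc s) g i j) = ?A + ?B"
    by (intro eq_matI) (auto simp: gram_def)
  then have "vec_space.rank n (mat n n (\<lambda>(i, j). gram (Suc s) g i j))
      \<le> vec_space.rank n ?A + vec_space.rank n ?B"
    using vec_space.rank_subadditive[of ?A n n ?B] by simp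
  moreover have "vec_space.rank n ?B \<le> 1"
    by (rule vec_space.rank_le_1_product_entries[of _ _ n "g s" "g s"]) auto
  ultimately show ?case using Suc.IH by simp
qed

section \<open>Optimal solutions of low rank\<close>

text \<open>
  The entries of a feasible array lie between \<open>-1\<close> and \<open>1\<close> by \<open>psd_on_minor\<close>, so the elliptope is
  compact. Entries outside of the index range are set to zero.
\<close>

lemma maximizer_exists: "\<exists>Y. maximizes n E w Y"
proof -
  define K where "K = {y :: nat \<times> nat \<Rightarrow> real. elliptope n (\<lambda>i j. y (i, j)) \<and>
    (\<forall>p. p \<notin> {..<n} \<times> {..<n} \<longrightarrow> y p = 0)}"
  have coord: "continuous_on UNIV (\<lambda>y :: nat \<times> nat \<Rightarrow> real. y p)" for p
    by (rule continuous_on_product_coordinates)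
  have "closed K" unfolding K_def elliptope_def psd_on_def Ball_def
    by (intro closed_Collect_conj closed_Collect_all closed_Collect_imp closed_Collect_eq
        closed_Collect_le continuous_intros coord) auto
  moreover have "K \<subseteq> {y. \<forall>p. \<bar>y p\<bar> \<le> 1}"
  proof clarify
    fix y :: "nat \<times> nat \<Rightarrow> real" and i j
    assume y: "y \<in> K"
    show "\<bar>y (i, j)\<bar> \<le> 1"
    proof (cases "i < n \<and> j < n")
      case True
      have psd: "psd_on {..<n} (\<lambda>i j. y (i, j))" using y by (simp add: K_def elliptope_def)
      have "(y (i, j))\<^sup>2 \<le> y (i, i) * y (j, j)"
        using psd_on_minor[OF psd, of i j] True by simp
      then have "(y (i, j))\<^sup>2 \<le> 1\<^sup>2" using y True by (simp add: K_def elliptope_def)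
      then show ?thesis using abs_le_square_iff[of "y (i, j)" 1] by simp
    next
      case False
      then show ?thesis using y by (auto simp: K_def)
    qed
  qed
  ultimately have "compact K"
    using compact_Int_closed[OF compact_cube, of K] by (simp add: Int_absorb1)
  moreover have restr: "(\<lambda>(i, j). if i < n \<and> j < n then Y i j else 0) \<in> K" if "elliptope n Y" for Y
    using that elliptope_cong[of n "\<lambda>i j. if i < n \<and> j < n then Y i j else 0" Y]
    by (auto simp: K_def)
  moreover have "K \<noteq> {}"
  proof -
    have "elliptope n (gram n (\<lambda>k i. if k = i then 1 else 0))"
      unfolding elliptope_def using psd_on_gram by (auto simp: gram_def if_distrib cong: if_cong)
    then show ?thesis using restr by blast
  qed
  moreover have "continuous_on K (\<lambda>y. edge_value n E w (\<lambda>i j. y (i, j)))"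
    unfolding edge_value_def case_prod_beta
    by (intro continuous_intros continuous_on_subset[OF coord subset_UNIV])
  ultimately obtain y where y: "y \<in> K"
    and max: "\<And>z. z \<in> K \<Longrightarrow> edge_value n E w (\<lambda>i j. z (i, j)) \<le> edge_value n E w (\<lambda>i j. y (i, j))"
    using continuous_attains_sup[of K "\<lambda>y. edge_value n E w (\<lambda>i j. y (i, j))"] by blast
  have "edge_value n E w Z \<le> edge_value n E w (\<lambda>i j. y (i, j))" if "elliptope n Z" for Z
    using max[OF restr[OF that]]
      edge_value_cong[of n "\<lambda>i j. if i < n \<and> j < n then Z i j else 0" Z E w] by simp
  then show ?thesis using y by (intro exI[of _ "\<lambda>i j. y (i, j)"]) (simp add: maximizes_def K_def)
qed

lemma congruence_gram:
  assumes "\<And>k l. k < s \<Longrightarrow> l < s \<Longrightarrow> G k l = gram m h k l"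
  shows "(\<Sum>k<s. \<Sum>l<s. g k i * G k l * g l j) = gram m (\<lambda>p i. \<Sum>k<s. h p k * g k i) i j"
proof -
  have "(\<Sum>k<s. \<Sum>l<s. g k i * G k l * g l j) = (\<Sum>k<s. \<Sum>l<s. \<Sum>p<m. (h p k * g k i) * (h p l * g l j))"
    by (intro sum.cong refl) (simp add: assms gram_def sum_distrib_left sum_distrib_right mult_ac)
  also have "\<dots> = (\<Sum>k<s. \<Sum>p<m. \<Sum>l<s. (h p k * g k i) * (h p l * g l j))"
    by (intro sum.cong refl) (rule sum.swap)
  also have "\<dots> = (\<Sum>p<m. \<Sum>k<s. \<Sum>l<s. (h p k * g k i) * (h p l * g l j))" by (rule sum.swap)
  finally show ?thesis by (simp add: gram_def sum_product)
qed

lemma congruence_identity_plus: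
  fixes g :: "nat \<Rightarrow> 'i \<Rightarrow> real"
  shows "(\<Sum>k<s. \<Sum>l<s. g k i * ((if k = l then 1 else 0) + t * R k l) * g l j) =
    gram s g i j + t * (\<Sum>k<s. \<Sum>l<s. g k i * R k l * g l j)"
proof -
  have "(\<Sum>k<s. \<Sum>l<s. g k i * ((if k = l then 1 else 0) + t * R k l) * g l j) =
    (\<Sum>k<s. \<Sum>l<s. (if k = l then g k i * g l j else 0) + t * (g k i * R k l * g l j))"
    by (intro sum.cong refl) (simp add: algebra_simps)
  then show ?thesis
    by (simp add: sum.distrib gram_def sum_distrib_left)
qed

text \<open>
  The symmetric matrices of size \<open>s\<close> form a space of dimension \<open>s (s + 1) / 2\<close>, and each of the \<open>n\<close>
  vectors imposes one linear condition. Changing the sign of a nonzero solution if necessary, its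
  form takes a negative value.
\<close>

lemma symmetric_annihilator_exists:
  fixes g :: "nat \<Rightarrow> nat \<Rightarrow> real"
  assumes "n < s * (s + 1) div 2"
  obtains R x where "\<And>k l. R k l = R l k"
    and "\<And>i. i < n \<Longrightarrow> (\<Sum>k<s. \<Sum>l<s. g k i * R k l * g l i) = 0"
    and "(\<Sum>k<s. \<Sum>l<s. x k * R k l * x l) < (0 :: real)"
proof -
  define P where "P = (SIGMA l:{..<s}. {..l})"
  have finP: "finite P" unfolding P_def by simp
  have "card P = (\<Sum>l<s. Suc l)" unfolding P_def by (simp add: card_SigmaI)
  also have "\<dots> = s * (s + 1) div 2" by (induction s) auto
  finally have "card {..<n} < card P" using assms by simp
  then obtain u where u: "\<exists>p\<in>P. u p \<noteq> 0"
    "\<And>i. i < n \<Longrightarrow> (\<Sum>p\<in>P. (g (fst p) i * g (snd p) i) * u p) = 0"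
    using underdetermined_system_nontrivial[of "{..<n}" P "\<lambda>i p. g (fst p) i * g (snd p) i"] finP
    by auto
  define U where "U = (\<lambda>k l. if (k, l) \<in> P then u (k, l) else 0)"
  define R where "R = (\<lambda>k l. U k l + U l k)"
  have sym: "R k l = R l k" for k l by (simp add: R_def)
  have ann: "(\<Sum>k<s. \<Sum>l<s. g k i * R k l * g l i) = 0" if "i < n" for i
  proof -
    \<comment> \<open>A form does not change under transposition, so both summands of R are treated alike.\<close>
    have half: "(\<Sum>k<s. \<Sum>l<s. g k i * U k l * g l i) = 0"
    proof -
      have "(\<Sum>k<s. \<Sum>l<s. g k i * U k l * g l i) = (\<Sum>p\<in>{..<s} \<times> {..<s}. g (fst p) i * U (fst p) (snd p) * g (snd p) i)"
        by (simp add: sum.cartesian_product case_prod_beta)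
      also have "\<dots> = (\<Sum>p\<in>P. g (fst p) i * U (fst p) (snd p) * g (snd p) i)"
        by (rule sum.mono_neutral_right) (auto simp: P_def U_def)
      also have "\<dots> = (\<Sum>p\<in>P. (g (fst p) i * g (snd p) i) * u p)"
        by (intro sum.cong refl) (auto simp: U_def)
      finally show ?thesis using u(2)[OF that] by simp
    qed
    have "(\<Sum>k<s. \<Sum>l<s. g k i * U l k * g l i) = (\<Sum>l<s. \<Sum>k<s. g l i * U l k * g k i)"
      by (subst sum.swap) (simp add: mult_ac)
    then have "(\<Sum>k<s. \<Sum>l<s. g k i * U l k * g l i) = 0" using half by simp
    then show ?thesis using half by (simp add: R_def algebra_simps sum.distrib)
  qed
  obtain a b where ab: "(a, b) \<in> P" "u (a, b) \<noteq> 0" using u(1) by auto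
  then have less: "a < s" "b \<le> a" by (auto simp: P_def)
  have Rab: "R a b \<noteq> 0"
    using ab less by (cases "a = b") (auto simp: R_def U_def P_def)
  let ?q = "\<lambda>x. \<Sum>k<s. \<Sum>l<s. x k * R k l * x l"
  have "\<exists>x. ?q x \<noteq> 0"
  proof (rule ccontr)
    assume "\<not> ?thesis"
    then have q0: "?q x = 0" for x by blast
    have sing: "R a a = 0" if "a < s" for a
    proof -
      have "?q (\<lambda>k. if k = a then 1 else 0) = R a a"
        using that by (simp add: if_distrib[of "\<lambda>x. x * _"] if_distrib[of "\<lambda>x. _ * x"] cong: if_cong)
      then show ?thesis using q0 by simp
    qed
    show False
    proof (cases "a = b")
      case True
      then show ?thesis using sing[of a] less Rab by simp
    next
      case False
      let ?x = "\<lambda>k. (if k = a then 1 else 0) + (if k = b then 1 else 0 :: real)"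
      have "?q ?x = R a a + R a b + R b a + R b b"
        using less by (simp add: distrib_left distrib_right sum.distrib
            if_distrib[of "\<lambda>x. x * _"] if_distrib[of "\<lambda>x. _ * x"] cong: if_cong)
      then show ?thesis using q0[of ?x] sing[of a] sing[of b] less Rab sym[of a b] by simp
    qed
  qed
  then obtain x where x: "?q x \<noteq> 0" by blast
  show thesis
  proof (cases "?q x < 0")
    case True
    then show ?thesis using that[of R x] sym ann by blast
  next
    case False
    have neg: "(\<Sum>k<s. \<Sum>l<s. y k * - R k l * z l) = - (\<Sum>k<s. \<Sum>l<s. y k * R k l * z l)" for y z
      by (simp add: sum_negf)
    show ?thesis
      using that[of "\<lambda>k l. - R k l" x] sym ann False x unfolding neg by auto
  qed
qed

text \<open>
  The rank reduction of Barvinok and Pataki. If the form of \<open>R\<close> vanishes at all vectors \<open>g\<^sub>i\<close>, then the arrays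
  \<open>g\<^sup>T (1 + t R) g\<close> have unit diagonal for all \<open>t\<close>, so they are feasible as long as \<open>1 + t R\<close> is
  semidefinite. This holds for small \<open>t\<close> of either sign, hence an optimal \<open>g\<close> makes the objective
  constant in \<open>t\<close>, and \<open>t\<close> may be increased until \<open>1 + t R\<close> becomes singular.
\<close>

lemma maximizer_rank_reduction:
  assumes max: "maximizes n E w (gram s g)" and "n < s * (s + 1) div 2"
  shows "\<exists>g'. maximizes n E w (gram (s - 1) g')"
proof -
  obtain R x where sym: "\<And>k l. R k l = R l k"
    and ann: "\<And>i. i < n \<Longrightarrow> (\<Sum>k<s. \<Sum>l<s. g k i * R k l * g l i) = 0"
    and neg: "(\<Sum>k<s. \<Sum>l<s. x k * R k l * x l) < (0 :: real)"
  proof (rule symmetric_annihilator_exists[OF assms(2), of g])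
  qed (rule that)
  define D where "D = (\<lambda>i j. \<Sum>k<s. \<Sum>l<s. g k i * R k l * g l j)"
  define Y where "Y = (\<lambda>t i j. gram s g i j + t * D i j)"
  have linear: "edge_value n E w (Y t) = edge_value n E w (gram s g) + t * edge_value n E w D" for t
    unfolding edge_value_def Y_def
    by (simp add: case_prod_beta algebra_simps sum.distrib sum_distrib_left)
  have diag: "Y t i i = 1" if "i < n" for t i
    using max ann[OF that] that unfolding Y_def D_def maximizes_def elliptope_def by simp
  have feasible: "elliptope n (Y t)" if psd: "psd_on {..<s} (\<lambda>k l. (if k = l then 1 else 0) + t * R k l)" for t
  proof -
    obtain h where h: "\<And>k l. k < s \<Longrightarrow> l < s \<Longrightarrow> (if k = l then 1 else 0) + t * R k l = gram s h k l"
      using psd_on_imp_gram[OF _ psd] by auto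
    have "Y t = gram s (\<lambda>p i. \<Sum>k<s. h p k * g k i)"
    proof (intro ext)
      fix i j
      show "Y t i j = gram s (\<lambda>p i. \<Sum>k<s. h p k * g k i) i j"
        using congruence_gram[OF h, where g = g and i = i and j = j]
        unfolding congruence_identity_plus Y_def D_def by simp
    qed
    then show ?thesis using diag[of _ t] by (simp add: elliptope_def psd_on_gram)
  qed
  have interior: "edge_value n E w D = 0"
  proof -
    \<comment> \<open>The sum bounds the form of R by \<open>abs_form_le\<close>; adding 1 makes M positive.\<close>
    define M where "M = (\<Sum>k<s. \<Sum>l<s. \<bar>R k l\<bar>) + 1"
    have M: "M > 0" unfolding M_def by (intro add_nonneg_pos sum_nonneg) auto
    have le: "t * edge_value n E w D \<le> 0" if t: "\<bar>t\<bar> = 1 / M" for t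
    proof -
      have "0 \<le> (\<Sum>k<s. \<Sum>l<s. z k * ((if k = l then 1 else 0) + t * R k l) * z l)" for z
      proof -
        have "\<bar>t * (\<Sum>k<s. \<Sum>l<s. z k * R k l * z l)\<bar> \<le> (1 / M) * (M * (\<Sum>k<s. (z k)\<^sup>2))"
          unfolding abs_mult t
          using abs_form_le[of "{..<s}" z R] M
          by (intro mult_left_mono) (auto simp: M_def distrib_right sum_nonneg intro: order_trans)
        then show ?thesis using M by (subst form_identity_plus) auto
      qed
      then have "psd_on {..<s} (\<lambda>k l. (if k = l then 1 else 0) + t * R k l)"
        unfolding psd_on_def using sym by auto
      then have "edge_value n E w (Y t) \<le> edge_value n E w (gram s g)"
        using max feasible unfolding maximizes_def by blast
      then show ?thesis using linear by simp
    qed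
    have "1 / M * edge_value n E w D \<le> 0" "- (1 / M) * edge_value n E w D \<le> 0"
      using le[of "1 / M"] le[of "- (1 / M)"] M by simp_all
    then show ?thesis using M by (simp add: divide_le_0_iff zero_le_divide_iff)
  qed
  obtain t h where h: "\<And>k l. k \<in> {..<s} \<Longrightarrow> l \<in> {..<s} \<Longrightarrow>
      (if k = l then 1 else 0) + t * R k l = gram (card {..<s} - 1) h k l"
    using identity_plus_boundary[of "{..<s}" R x] sym neg by auto
  let ?g' = "\<lambda>p i. \<Sum>k<s. h p k * g k i"
  have Y: "Y t = gram (s - 1) ?g'"
  proof (intro ext)
    fix i j
    show "Y t i j = gram (s - 1) ?g' i j"
      using congruence_gram[of s "\<lambda>k l. (if k = l then 1 else 0) + t * R k l" "s - 1" h g i j] h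
      unfolding congruence_identity_plus Y_def D_def by simp
  qed
  have "elliptope n (gram (s - 1) ?g')"
    using diag[of _ t] unfolding elliptope_def Y by (simp add: psd_on_gram)
  moreover have "edge_value n E w (gram (s - 1) ?g') = edge_value n E w (gram s g)"
    using linear[of t] interior Y by simp
  ultimately show ?thesis using max unfolding maximizes_def by (intro exI[of _ ?g']) simp
qed

text \<open>
  A Gram representation of an optimum in the least possible dimension cannot be reduced further.
\<close>

theorem low_rank_optimum_exists:
  "\<exists>X s. sdp_optimal n E w X \<and> vec_space.rank n X \<le> s \<and> s * (s + 1) div 2 \<le> n"
proof -
  let ?P = "\<lambda>s. \<exists>g. maximizes n E w (gram s g)"
  obtain Y where Y: "maximizes n E w Y" using maximizer_exists by blast
  then obtain g where "\<And>i j. i < n \<Longrightarrow> j < n \<Longrightarrow> Y i j = gram n g i j"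
    using psd_on_imp_gram[of "{..<n}" Y] by (auto simp: maximizes_def elliptope_def)
  then have "?P n" using Y maximizes_cong[of n Y "gram n g"] by blast
  define s where "s = (LEAST s. ?P s)"
  have "?P s" unfolding s_def by (rule LeastI[of ?P, OF \<open>?P n\<close>])
  then obtain g where g: "maximizes n E w (gram s g)" by blast
  have "s * (s + 1) div 2 \<le> n"
  proof (rule ccontr)
    assume "\<not> ?thesis"
    then have lt: "n < s * (s + 1) div 2" by simp
    then have "s - 1 < s" by (cases s) auto
    moreover have "s \<le> s - 1"
      unfolding s_def using maximizer_rank_reduction[OF g lt] by (intro Least_le) (simp add: s_def)
    ultimately show False by simp
  qed
  moreover have "sdp_optimal n E w (mat n n (\<lambda>(i, j). gram s g i j))"
    unfolding sdp_optimal_iff_maximizes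
    using g maximizes_cong[of n "\<lambda>i j. mat n n (\<lambda>(i, j). gram s g i j) $$ (i, j)" "gram s g" E w] by simp
  ultimately show ?thesis using rank_gram_le by blast
qed

section \<open>Certificates for a lower bound on the rank\<close>

text \<open>
  The quadratic forms whose matrix is supported on the diagonal and on the edges. The
  sign of the edge part makes \<open>w\<close> an objective of the semidefinite program, see \<open>edge_form_weight\<close>.
\<close>

definition edge_form :: "nat \<Rightarrow> nat set set \<Rightarrow> ((nat \<Rightarrow> real) \<Rightarrow> real) \<Rightarrow> bool" where
  "edge_form n E q \<longleftrightarrow> (\<exists>d w. \<forall>y. q y =
     (\<Sum>i<n. d i * (y i)\<^sup>2) - (\<Sum>(i, j) \<in> edge_pairs n E. w i j * (y i * y j)))"

lemma edge_form_zero: "edge_form n E (\<lambda>y. 0)"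
  unfolding edge_form_def by (intro exI[of _ "\<lambda>_. 0"] exI[of _ "\<lambda>_ _. 0"]) simp

lemma edge_form_add:
  assumes "edge_form n E p" and "edge_form n E q"
  shows "edge_form n E (\<lambda>y. p y + q y)"
proof -
  obtain d w where p: "\<And>y. p y = (\<Sum>i<n. d i * (y i)\<^sup>2) - (\<Sum>(i, j) \<in> edge_pairs n E. w i j * (y i * y j))"
    using assms(1) unfolding edge_form_def by blast
  obtain d' w' where q: "\<And>y. q y = (\<Sum>i<n. d' i * (y i)\<^sup>2) - (\<Sum>(i, j) \<in> edge_pairs n E. w' i j * (y i * y j))"
    using assms(2) unfolding edge_form_def by blast
  show ?thesis unfolding edge_form_def
    by (intro exI[of _ "\<lambda>i. d i + d' i"] exI[of _ "\<lambda>i j. w i j + w' i j"])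
       (simp add: p q case_prod_beta sum.distrib distrib_right)
qed

lemma edge_form_mult:
  assumes "edge_form n E q"
  shows "edge_form n E (\<lambda>y. c * q y)"
proof -
  obtain d w where q: "\<And>y. q y = (\<Sum>i<n. d i * (y i)\<^sup>2) - (\<Sum>(i, j) \<in> edge_pairs n E. w i j * (y i * y j))"
    using assms unfolding edge_form_def by blast
  show ?thesis unfolding edge_form_def
    by (intro exI[of _ "\<lambda>i. c * d i"] exI[of _ "\<lambda>i j. c * w i j"])
       (simp add: q case_prod_beta right_diff_distrib sum_distrib_left mult.assoc)
qed

lemma edge_form_diff:
  "edge_form n E p \<Longrightarrow> edge_form n E q \<Longrightarrow> edge_form n E (\<lambda>y. p y - q y)"
  using edge_form_add[of n E p "\<lambda>y. -1 * q y"] edge_form_mult[of n E q "-1"] by simp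

lemma edge_form_sum:
  "(\<And>a. a \<in> S \<Longrightarrow> edge_form n E (q a)) \<Longrightarrow> edge_form n E (\<lambda>y. \<Sum>a\<in>S. q a y)"
  by (induction S rule: infinite_finite_induct) (auto intro: edge_form_zero edge_form_add)

lemma edge_form_square:
  assumes "i < n"
  shows "edge_form n E (\<lambda>y. (y i)\<^sup>2)"
  unfolding edge_form_def
  using assms by (intro exI[of _ "\<lambda>k. if k = i then 1 else 0"] exI[of _ "\<lambda>_ _. 0"])
    (simp add: if_distrib[of "\<lambda>x. x * _"] cong: if_cong)

lemma edge_form_edge:
  assumes "i < n" and "j < n" and "i \<noteq> j" and "{i, j} \<in> E"
  shows "edge_form n E (\<lambda>y. y i * y j)"
proof -
  have *: "edge_form n E (\<lambda>y. y i * y j)" if "i < j" "j < n" "{i, j} \<in> E" for i j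
  proof -
    let ?w = "\<lambda>a b. if (a, b) = (i, j) then -1 else (0 :: real)"
    have "(\<Sum>(a, b) \<in> edge_pairs n E. ?w a b * (y a * y b)) = - (y i * y j)" for y
    proof -
      have "(\<Sum>(a, b) \<in> edge_pairs n E. ?w a b * (y a * y b)) =
        (\<Sum>p \<in> edge_pairs n E. if p = (i, j) then - (y i * y j) else 0)"
        by (intro sum.cong refl) (auto split: if_splits)
      also have "\<dots> = - (y i * y j)" using that by (subst sum.delta[OF finite_edge_pairs]) (auto simp: edge_pairs_def)
      finally show ?thesis .
    qed
    then show ?thesis unfolding edge_form_def
      by (intro exI[of _ "\<lambda>_. 0"] exI[of _ ?w]) simp
  qed
  show ?thesis
    using *[of i j] *[of j i] assms by (cases "i < j") (auto simp: insert_commute mult.commute)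
qed

text \<open>
  Summing an edge form over the rows of a Gram representation evaluates its diagonal part on the unit
  diagonal, which gives a constant, and its edge part on the entries at the edges.
\<close>

lemma edge_form_weight:
  assumes "edge_form n E q"
  shows "\<exists>c w. \<forall>m g. elliptope n (gram m g) \<longrightarrow>
    edge_value n E w (gram m g) = c - (\<Sum>k<m. q (g k))"
proof -
  obtain d w where q: "\<And>y. q y = (\<Sum>i<n. d i * (y i)\<^sup>2) - (\<Sum>(i, j) \<in> edge_pairs n E. w i j * (y i * y j))"
    using assms unfolding edge_form_def by blast
  have "edge_value n E w (gram m g) = (\<Sum>i<n. d i) - (\<Sum>k<m. q (g k))" if "elliptope n (gram m g)" for m g
  proof -
    have "(\<Sum>k<m. \<Sum>i<n. d i * (g k i)\<^sup>2) = (\<Sum>i<n. d i * gram m g i i)"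
      by (subst sum.swap) (simp add: gram_def sum_distrib_left power2_eq_square)
    also have "\<dots> = (\<Sum>i<n. d i)" using that by (intro sum.cong refl) (simp add: elliptope_def)
    finally have diag: "(\<Sum>k<m. \<Sum>i<n. d i * (g k i)\<^sup>2) = (\<Sum>i<n. d i)" .
    have "(\<Sum>k<m. \<Sum>(i, j) \<in> edge_pairs n E. w i j * (g k i * g k j)) = edge_value n E w (gram m g)"
      by (subst sum.swap) (simp add: edge_value_def gram_def sum_distrib_left case_prod_beta)
    then show ?thesis by (simp add: q sum_subtractf diag)
  qed
  then show ?thesis by blast
qed

lemma rank_ge_orthonormal:
  fixes X :: "real mat"
  assumes X: "X \<in> carrier_mat n n" and J: "J \<subseteq> {..<n}"
    and id: "\<And>i j. i \<in> J \<Longrightarrow> j \<in> J \<Longrightarrow> X $$ (i, j) = (if i = j then 1 else 0)"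
  shows "card J \<le> vec_space.rank n X"
proof -
  have fin: "finite J" using J finite_subset by blast
  have set: "{j. j < n \<and> j \<in> J} = J" using J by auto
  have "submatrix X J J = 1\<^sub>m (card J)"
  proof (rule eq_matI)
    fix i j assume "i < dim_row (1\<^sub>m (card J) :: real mat)" "j < dim_col (1\<^sub>m (card J) :: real mat)"
    then have ij: "i < card J" "j < card J" by auto
    have "pick J i = pick J j \<longleftrightarrow> i = j"
      using ij card_pick[of i J] card_pick[of j J] by metis
    then show "submatrix X J J $$ (i, j) = 1\<^sub>m (card J) $$ (i, j)"
      using X ij set id[of "pick J i" "pick J j"] pick_in_set_le[of i J] pick_in_set_le[of j J]
      by (auto simp: submatrix_def)
  qed (use X set in \<open>auto simp: submatrix_def\<close>)
  then have "det (submatrix X J J) \<noteq> 0" by simp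
  then show ?thesis using vec_space.rank_gt_minor[OF X, of J J] set by simp
qed

text \<open>
  The dual certificate. A nonnegative edge form \<open>q\<close> bounds the objective that belongs to it, and
  the bound is attained at a feasible array whose rows are zeros of \<open>q\<close>. Then all rows of every optimum
  are zeros of \<open>q\<close>. If the zeros of \<open>q\<close> obey so many linear relations that the vectors of \<open>J\<close> must be
  orthonormal, every optimum contains an identity submatrix of size \<open>card J\<close>.
\<close>

lemma edge_form_forces_rank:
  assumes form: "edge_form n E q" and nonneg: "\<And>y. q y \<ge> 0"
    and feasible: "elliptope n (gram s p)" and zero: "\<And>k. k < s \<Longrightarrow> q (p k) = 0"
    and J: "J \<subseteq> {..<n}"
    and orthonormal: "\<And>m g i j. elliptope n (gram m g) \<Longrightarrow> (\<And>k. k < m \<Longrightarrow> q (g k) = 0) \<Longrightarrow>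
      i \<in> J \<Longrightarrow> j \<in> J \<Longrightarrow> gram m g i j = (if i = j then 1 else 0)"
  shows "\<exists>w. \<forall>X. sdp_optimal n E w X \<longrightarrow> card J \<le> vec_space.rank n X"
proof -
  obtain c w where "\<forall>m g. elliptope n (gram m g) \<longrightarrow>
    edge_value n E w (gram m g) = c - (\<Sum>k<m. q (g k))"
    using edge_form_weight[OF form] by blast
  then have val: "edge_value n E w (gram m g) = c - (\<Sum>k<m. q (g k))"
    if "elliptope n (gram m g)" for m g using that by blast
  have "card J \<le> vec_space.rank n X" if opt: "sdp_optimal n E w X" for X
  proof -
    let ?Y = "\<lambda>i j. X $$ (i, j)"
    have X: "X \<in> carrier_mat n n" and max: "maximizes n E w ?Y"
      using opt by (auto simp: sdp_optimal_iff_maximizes)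
    obtain g where g: "\<And>i j. i < n \<Longrightarrow> j < n \<Longrightarrow> ?Y i j = gram n g i j"
      using psd_on_imp_gram[of "{..<n}" ?Y] max by (auto simp: maximizes_def elliptope_def)
    then have max': "maximizes n E w (gram n g)"
      using max maximizes_cong[of n ?Y "gram n g"] by blast
    then have ell: "elliptope n (gram n g)" by (simp add: maximizes_def)
    have "edge_value n E w (gram s p) \<le> edge_value n E w (gram n g)"
      using max' feasible by (simp add: maximizes_def)
    then have "c - (\<Sum>k<s. q (p k)) \<le> c - (\<Sum>k<n. q (g k))"
      unfolding val[OF feasible] val[OF ell] .
    then have "(\<Sum>k<n. q (g k)) \<le> 0" using zero by simp
    then have "(\<Sum>k<n. q (g k)) = 0" using nonneg by (simp add: order_antisym sum_nonneg)
    then have "q (g k) = 0" if "k < n" for k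
      using that nonneg by (simp add: sum_nonneg_eq_0_iff)
    note orth = orthonormal[OF ell this]
    have "X $$ (i, j) = (if i = j then 1 else 0)" if "i \<in> J" "j \<in> J" for i j
    proof -
      have "i < n" "j < n" using that J by auto
      then show ?thesis using g[of i j] orth[OF _ that] by simp
    qed
    then show ?thesis by (rule rank_ge_orthonormal[OF X J])
  qed
  then show ?thesis by blast
qed

section \<open>Perturbations of the identity matrix\<close>

text \<open>
  Sum the bounds over \<open>I\<close>.
\<close>

lemma small_relative_to_sum_imp_zero:
  fixes x :: "'i \<Rightarrow> real"
  assumes "finite I" and "\<epsilon> * real (card I) < 1" and nonneg: "\<And>i. i \<in> I \<Longrightarrow> 0 \<le> x i"
    and le: "\<And>i. i \<in> I \<Longrightarrow> x i \<le> \<epsilon> * (\<Sum>j\<in>I. x j)"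
  shows "\<forall>i\<in>I. x i = 0"
proof -
  let ?S = "\<Sum>j\<in>I. x j"
  have S: "0 \<le> ?S" using nonneg by (intro sum_nonneg)
  have "?S \<le> (\<Sum>i\<in>I. \<epsilon> * ?S)" by (intro sum_mono le)
  then have "(1 - \<epsilon> * real (card I)) * ?S \<le> 0" by (simp add: algebra_simps)
  then have "?S \<le> 0" using assms(2) by (simp add: mult_le_0_iff)
  then have "?S = 0" using S by simp
  then show ?thesis using assms(1) nonneg by (simp add: sum_nonneg_eq_0_iff)
qed

lemma perturbed_identity_injective:
  fixes K :: "'i \<Rightarrow> 'i \<Rightarrow> real"
  assumes "finite I" and "0 < \<epsilon>" and "\<epsilon> * real (card I) < 1" and K: "\<And>i j. \<bar>K i j\<bar> \<le> 1"
    and zero: "\<And>i. i \<in> I \<Longrightarrow> x i + \<epsilon> * (\<Sum>j\<in>I. K i j * x j) = 0"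
  shows "\<forall>i\<in>I. x i = 0"
proof -
  have "\<bar>x i\<bar> \<le> \<epsilon> * (\<Sum>j\<in>I. \<bar>x j\<bar>)" if "i \<in> I" for i
  proof -
    have "\<bar>\<Sum>j\<in>I. K i j * x j\<bar> \<le> (\<Sum>j\<in>I. \<bar>K i j * x j\<bar>)" by (rule sum_abs)
    also have "\<dots> \<le> (\<Sum>j\<in>I. \<bar>x j\<bar>)"
      using K by (intro sum_mono) (simp add: abs_mult mult_left_le_one_le)
    finally have "\<epsilon> * \<bar>\<Sum>j\<in>I. K i j * x j\<bar> \<le> \<epsilon> * (\<Sum>j\<in>I. \<bar>x j\<bar>)"
      using assms(2) by simp
    moreover have "\<bar>x i\<bar> = \<epsilon> * \<bar>\<Sum>j\<in>I. K i j * x j\<bar>"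
    proof -
      have "x i = - (\<epsilon> * (\<Sum>j\<in>I. K i j * x j))" using zero[OF that] by simp
      then show ?thesis using assms(2) by (simp add: abs_mult)
    qed
    ultimately show ?thesis by simp
  qed
  then have "\<forall>i\<in>I. \<bar>x i\<bar> = 0"
    by (intro small_relative_to_sum_imp_zero[OF assms(1,3)]) auto
  then show ?thesis by simp
qed

text \<open>
  An M-matrix has a nonnegative inverse: the negative parts of \<open>x\<close> satisfy the hypothesis of
  \<open>small_relative_to_sum_imp_zero\<close>.
\<close>

lemma perturbed_identity_monotone:
  fixes C :: "'i \<Rightarrow> 'i \<Rightarrow> real"
  assumes "finite I" and "0 < \<epsilon>" and "\<epsilon> * real (card I) < 1" and C: "\<And>i j. 0 \<le> C i j \<and> C i j \<le> 1"
    and nonneg: "\<And>i. i \<in> I \<Longrightarrow> 0 \<le> x i - \<epsilon> * (\<Sum>j\<in>I. C i j * x j)"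
  shows "\<forall>i\<in>I. 0 \<le> x i"
proof -
  define y where "y = (\<lambda>i. max 0 (- x i))"
  have "y i \<le> \<epsilon> * (\<Sum>j\<in>I. y j)" if "i \<in> I" for i
  proof -
    have "- (C i j * x j) \<le> y j" for j
    proof (cases "x j \<ge> 0")
      case True
      then have "0 \<le> C i j * x j" using C by simp
      then show ?thesis by (simp add: y_def)
    next
      case False
      then have "C i j * (- x j) \<le> 1 * (- x j)" using C by (intro mult_right_mono) auto
      then show ?thesis by (simp add: y_def)
    qed
    then have "(\<Sum>j\<in>I. - (C i j * x j)) \<le> (\<Sum>j\<in>I. y j)" by (intro sum_mono)
    then have "\<epsilon> * (\<Sum>j\<in>I. - (C i j * x j)) \<le> \<epsilon> * (\<Sum>j\<in>I. y j)"
      using assms(2) by simp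
    then have "- x i \<le> \<epsilon> * (\<Sum>j\<in>I. y j)"
      using nonneg[OF that] by (simp add: sum_negf)
    moreover have "0 \<le> \<epsilon> * (\<Sum>j\<in>I. y j)"
      using assms(2) by (intro mult_nonneg_nonneg sum_nonneg) (auto simp: y_def)
    ultimately show ?thesis by (simp add: y_def)
  qed
  then have "\<forall>i\<in>I. y i = 0"
    by (intro small_relative_to_sum_imp_zero[OF assms(1,3)]) (auto simp: y_def)
  then show ?thesis by (auto simp: y_def max_def split: if_splits)
qed

text \<open>
  The parameters of the stress. For \<open>I = {3..r}\<close>, the matrix \<open>T = 1 - \<epsilon> C\<close> holds the coefficients of the
  products of two nodes \<open>v\<^sub>1\<^sub>i\<close>, and \<open>B = 1 + \<epsilon> D\<close>, up to sign, those of products of a node \<open>v\<^sub>1\<^sub>i\<close> and a node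
  \<open>v\<^sub>k\<close>. The \<open>0/1\<close> matrices \<open>C\<close> and \<open>D\<close> prescribe where these coefficients may be nonzero. A semidefinite
  matrix of rank \<open>card I\<close> with these blocks must have the third block \<open>B\<^sup>T T\<^sup>-\<^sup>1 B\<close> at the products of
  nodes \<open>v\<^sub>k v\<^sub>l\<close>, and the point of the signs is that this block is positive wherever \<open>C\<close> or \<open>D\<close> links
  \<open>k\<close> and \<open>l\<close>: off the diagonal \<open>T\<close> is nonpositive, hence \<open>T\<^sup>-\<^sup>1\<close> is nonnegative.
\<close>

locale link_pattern =
  fixes I :: "nat set" and C D :: "nat \<Rightarrow> nat \<Rightarrow> real"
  assumes finite_I: "finite I" and I_nonempty: "I \<noteq> {}"
    and C_range: "C i j \<in> {0, 1}" and D_range: "D i j \<in> {0, 1}"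
    and C_diag: "C i i = 0" and D_diag: "D i i = 0"
    and C_sym: "C i j = C j i"
begin

text \<open>
  Any positive number below \<open>1 / card I\<^sup>2\<close> serves: it makes \<open>T\<close> positive definite, and \<open>T\<close> and \<open>B\<close>
  injective.
\<close>

definition \<epsilon> :: real where "\<epsilon> = 1 / (real (card I) * real (card I) + 1)"

definition T :: "nat \<Rightarrow> nat \<Rightarrow> real" where "T i j = (if i = j then 1 else 0) - \<epsilon> * C i j"

definition B :: "nat \<Rightarrow> nat \<Rightarrow> real" where "B i j = (if i = j then 1 else 0) + \<epsilon> * D i j"

lemma C_bounds: "0 \<le> C i j \<and> C i j \<le> 1" "\<bar>C i j\<bar> \<le> 1"
  using C_range[of i j] by auto

lemma D_bounds: "0 \<le> D i j" "\<bar>D i j\<bar> \<le> 1"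
  using D_range[of i j] by auto

lemma eps_pos: "0 < \<epsilon>"
  unfolding \<epsilon>_def by (simp add: add_nonneg_pos)

lemma eps_card_square: "\<epsilon> * (real (card I) * real (card I)) < 1"
  unfolding \<epsilon>_def by (simp add: add_nonneg_pos)

lemma eps_card: "\<epsilon> * real (card I) < 1"
proof -
  have "1 \<le> card I" using finite_I I_nonempty by (simp add: Suc_leI card_gt_0_iff)
  then have "\<epsilon> * (real (card I) * 1) \<le> \<epsilon> * (real (card I) * real (card I))"
    using eps_pos by (intro mult_left_mono) auto
  then show ?thesis using eps_card_square by simp
qed

lemma T_sym: "T i j = T j i"
  by (simp add: T_def C_sym[of i j])

lemma T_apply: "i \<in> I \<Longrightarrow> (\<Sum>j\<in>I. T i j * x j) = x i - \<epsilon> * (\<Sum>j\<in>I. C i j * x j)"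
  using finite_I
  by (simp add: T_def left_diff_distrib sum_subtractf sum_distrib_left mult.assoc
      if_distrib[of "\<lambda>x. x * _"] cong: if_cong)

lemma B_apply: "i \<in> I \<Longrightarrow> (\<Sum>j\<in>I. B i j * x j) = x i + \<epsilon> * (\<Sum>j\<in>I. D i j * x j)"
  using finite_I
  by (simp add: B_def distrib_right sum.distrib sum_distrib_left mult.assoc
      if_distrib[of "\<lambda>x. x * _"] cong: if_cong)

lemma B_injective:
  assumes "\<And>i. i \<in> I \<Longrightarrow> (\<Sum>j\<in>I. B i j * x j) = 0"
  shows "\<forall>i\<in>I. x i = 0"
proof (rule perturbed_identity_injective[OF finite_I eps_pos eps_card])
  show "x i + \<epsilon> * (\<Sum>j\<in>I. D i j * x j) = 0" if "i \<in> I" for i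
    using assms[OF that] unfolding B_apply[OF that] .
qed (rule D_bounds)

lemma T_form_lower_bound:
  "(1 - \<epsilon> * (real (card I) * real (card I))) * (\<Sum>i\<in>I. (x i)\<^sup>2) \<le> (\<Sum>i\<in>I. \<Sum>j\<in>I. x i * T i j * x j)"
proof -
  have "(\<Sum>i\<in>I. \<Sum>j\<in>I. x i * C i j * x j) \<le> (\<Sum>i\<in>I. \<Sum>j\<in>I. \<bar>C i j\<bar>) * (\<Sum>i\<in>I. (x i)\<^sup>2)"
    using abs_form_le[OF finite_I, of x C] by simp
  also have "\<dots> \<le> (\<Sum>i\<in>I. \<Sum>j\<in>I. 1) * (\<Sum>i\<in>I. (x i)\<^sup>2)"
    using C_bounds by (intro mult_right_mono sum_mono sum_nonneg) auto
  finally have "\<epsilon> * (\<Sum>i\<in>I. \<Sum>j\<in>I. x i * C i j * x j)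
      \<le> \<epsilon> * (real (card I) * real (card I) * (\<Sum>i\<in>I. (x i)\<^sup>2))"
    using eps_pos by simp
  moreover have "(\<Sum>i\<in>I. \<Sum>j\<in>I. x i * T i j * x j) =
      (\<Sum>i\<in>I. (x i)\<^sup>2) + - \<epsilon> * (\<Sum>i\<in>I. \<Sum>j\<in>I. x i * C i j * x j)"
    unfolding form_identity_plus[OF finite_I, symmetric] by (simp add: T_def)
  ultimately show ?thesis by (simp add: algebra_simps)
qed

lemma T_form_nonneg: "0 \<le> (\<Sum>i\<in>I. \<Sum>j\<in>I. x i * T i j * x j)"
proof -
  have "0 \<le> (1 - \<epsilon> * (real (card I) * real (card I))) * (\<Sum>i\<in>I. (x i)\<^sup>2)"
    using eps_card_square by (intro mult_nonneg_nonneg sum_nonneg) auto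
  then show ?thesis using T_form_lower_bound by (rule order_trans)
qed

lemma T_form_eq_0:
  assumes "(\<Sum>i\<in>I. \<Sum>j\<in>I. x i * T i j * x j) = 0" and "i \<in> I"
  shows "x i = 0"
proof -
  have "(\<Sum>i\<in>I. (x i)\<^sup>2) \<le> 0"
    using T_form_lower_bound[of x] assms(1) eps_card_square by (simp add: mult_le_0_iff)
  then have "(\<Sum>i\<in>I. (x i)\<^sup>2) = 0" by (simp add: order_antisym sum_nonneg)
  then show ?thesis using assms(2) finite_I by (simp add: sum_nonneg_eq_0_iff)
qed

lemma T_total_pos: "0 < (\<Sum>i\<in>I. \<Sum>j\<in>I. T i j)"
proof -
  have "(\<Sum>i\<in>I. \<Sum>j\<in>I. T i j) \<noteq> 0"
    using T_form_eq_0[of "\<lambda>_. 1"] I_nonempty by auto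
  then show ?thesis using T_form_nonneg[of "\<lambda>_. 1"] by simp
qed

text \<open>
  \<open>T\<^sup>-\<^sup>1 B\<close>, characterized by \<open>T_A\<close>.
\<close>

definition A :: "nat \<Rightarrow> nat \<Rightarrow> real" where
  "A = (SOME A. \<forall>k. \<forall>i\<in>I. (\<Sum>j\<in>I. T i j * A j k) = B i k)"

lemma T_A: "i \<in> I \<Longrightarrow> (\<Sum>j\<in>I. T i j * A j k) = B i k"
proof -
  have solvable: "\<exists>x. \<forall>i\<in>I. (\<Sum>j\<in>I. T i j * x j) = B i k" for k
  proof (rule injective_system_solvable[OF finite_I])
    fix x assume zero: "\<And>i. i \<in> I \<Longrightarrow> (\<Sum>j\<in>I. T i j * x j) = 0"
    have "x i + \<epsilon> * (\<Sum>j\<in>I. - C i j * x j) = 0" if "i \<in> I" for i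
      using zero[OF that] unfolding T_apply[OF that] by (simp only: mult_minus_left sum_negf mult_minus_right diff_conv_add_uminus)
    then show "\<forall>j\<in>I. x j = 0"
      by (rule perturbed_identity_injective[OF finite_I eps_pos eps_card, rotated])
         (use C_bounds in auto)
  qed
  from choice[OF allI[OF solvable]]
  obtain x where "\<forall>k. \<forall>i\<in>I. (\<Sum>j\<in>I. T i j * x k j) = B i k" ..
  then have "\<exists>A. \<forall>k. \<forall>i\<in>I. (\<Sum>j\<in>I. T i j * A j k) = B i k" by (intro exI[of _ "\<lambda>j k. x k j"])
  then have "\<forall>k. \<forall>i\<in>I. (\<Sum>j\<in>I. T i j * A j k) = B i k" unfolding A_def by (rule someI_ex)
  then show "i \<in> I \<Longrightarrow> (\<Sum>j\<in>I. T i j * A j k) = B i k" by blast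
qed

text \<open>
  \<open>T A = B\<close> and \<open>B\<close> is injective.
\<close>

lemma A_injective:
  assumes "\<And>i. i \<in> I \<Longrightarrow> (\<Sum>k\<in>I. A i k * x k) = 0"
  shows "\<forall>i\<in>I. x i = 0"
proof (rule B_injective)
  fix i assume "i \<in> I"
  then have "(\<Sum>k\<in>I. B i k * x k) = (\<Sum>k\<in>I. \<Sum>j\<in>I. T i j * (A j k * x k))"
    by (simp add: T_A[symmetric] sum_distrib_right mult.assoc)
  also have "\<dots> = (\<Sum>j\<in>I. T i j * (\<Sum>k\<in>I. A j k * x k))"
    by (subst sum.swap) (simp add: sum_distrib_left)
  finally show "(\<Sum>k\<in>I. B i k * x k) = 0" using assms by simp
qed

lemma A_eq: "i \<in> I \<Longrightarrow> A i k = B i k + \<epsilon> * (\<Sum>j\<in>I. C i j * A j k)"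
  using T_A[of i k] T_apply[of i "\<lambda>j. A j k"] by simp

lemma B_nonneg: "0 \<le> B i k"
  using eps_pos D_bounds by (simp add: B_def)

lemma A_nonneg: "i \<in> I \<Longrightarrow> 0 \<le> A i k"
proof -
  have "\<forall>i\<in>I. 0 \<le> A i k"
  proof (rule perturbed_identity_monotone[OF finite_I eps_pos eps_card])
    show "0 \<le> A i k - \<epsilon> * (\<Sum>j\<in>I. C i j * A j k)" if "i \<in> I" for i
      using A_eq[OF that, of k] B_nonneg[of i k] by linarith
  qed (rule C_bounds)
  then show "i \<in> I \<Longrightarrow> 0 \<le> A i k" by blast
qed

lemma A_lower_bound:
  assumes "i \<in> I" and "j \<in> I"
  shows "B i k + \<epsilon> * (C i j * A j k) \<le> A i k"
proof -
  have "C i j * A j k \<le> (\<Sum>j\<in>I. C i j * A j k)"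
    using assms(2) finite_I C_bounds A_nonneg by (intro member_le_sum) auto
  then show ?thesis using A_eq[OF assms(1), of k] eps_pos by simp
qed

text \<open>
  The matrix \<open>B\<^sup>T T\<^sup>-\<^sup>1 B\<close>.
\<close>

definition NN :: "nat \<Rightarrow> nat \<Rightarrow> real" where "NN k l = (\<Sum>i\<in>I. A i k * B i l)"

lemma NN_sym: "NN k l = NN l k"
proof -
  have NN: "NN k l = (\<Sum>i\<in>I. \<Sum>j\<in>I. A i k * (T i j * A j l))" for k l
    unfolding NN_def by (intro sum.cong refl) (simp add: T_A[symmetric] sum_distrib_left)
  have "NN k l = (\<Sum>j\<in>I. \<Sum>i\<in>I. A i k * (T i j * A j l))" unfolding NN by (rule sum.swap)
  also have "\<dots> = NN l k" unfolding NN by (intro sum.cong refl) (simp add: T_sym mult_ac)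
  finally show ?thesis .
qed

lemma NN_nonneg: "0 \<le> NN k l"
  unfolding NN_def using A_nonneg B_nonneg by (intro sum_nonneg mult_nonneg_nonneg)

text \<open>
  Everything is nonnegative, so it suffices to find one positive contribution: a pair linked through
  \<open>D\<close> contributes through \<open>B\<close>, and a pair linked through \<open>C\<close> through the first-order term of \<open>T\<^sup>-\<^sup>1\<close>.
\<close>

lemma NN_pos:
  assumes "k \<in> I" and "l \<in> I" and "k \<noteq> l" and "C k l = 1 \<or> D k l = 1 \<or> D l k = 1"
  shows "0 < NN k l"
proof -
  have "A k k * B k l + A l k * B l l = (\<Sum>i\<in>{k, l}. A i k * B i l)" using assms(3) by simp
  also have "\<dots> \<le> NN k l"
    unfolding NN_def using assms(1,2) finite_I A_nonneg B_nonneg by (intro sum_mono2) auto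
  finally have le: "A k k * B k l + A l k * B l l \<le> NN k l" .
  have Akk: "1 \<le> A k k" using A_lower_bound[OF assms(1,1), of k] by (simp add: C_diag D_diag B_def)
  have Bkl: "B k l = \<epsilon> * D k l" "B l k = \<epsilon> * D l k" "B l l = 1" using assms(3) by (auto simp: B_def D_diag)
  have "\<epsilon> * D l k + \<epsilon> * (C k l * A k k) \<le> A l k"
    using A_lower_bound[OF assms(2,1), of k] Bkl C_sym[of k l] by simp
  then have "A k k * (\<epsilon> * D k l) + \<epsilon> * D l k + \<epsilon> * (C k l * A k k) \<le> NN k l"
    using le Bkl by simp
  moreover have "0 \<le> A k k * (\<epsilon> * D k l)" "0 \<le> \<epsilon> * D l k" "0 \<le> \<epsilon> * (C k l * A k k)"
    using Akk eps_pos C_bounds D_bounds by simp_all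
  moreover have "0 < A k k * (\<epsilon> * D k l) \<or> 0 < \<epsilon> * D l k \<or> 0 < \<epsilon> * (C k l * A k k)"
    using assms(4) Akk eps_pos by auto
  ultimately show ?thesis by linarith
qed

lemma B_column_pos: "k \<in> I \<Longrightarrow> 0 < (\<Sum>i\<in>I. B i k)"
  using finite_I B_nonneg by (intro sum_pos2[of _ k]) (auto simp: B_def D_diag)

end

section \<open>Expansion of quadratic forms\<close>

lemma sum_square_split:
  fixes g :: "nat \<Rightarrow> nat \<Rightarrow> real"
  assumes sym: "\<And>k l. g k l = g l k"
  shows "(\<Sum>k\<in>{3..r}. \<Sum>l\<in>{3..r}. g k l) = (\<Sum>k\<in>{3..r}. g k k) + (\<Sum>(k, l)\<in>index_pairs r. 2 * g k l)"
proof -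
  let ?D = "(\<lambda>k. (k, k)) ` {3..r}" and ?P = "index_pairs r" and ?P' = "prod.swap ` index_pairs r"
  have fin: "finite ?P"
    by (rule finite_subset[of _ "{3..r} \<times> {3..r}"]) (auto simp: index_pairs_def)
  have union: "{3..r} \<times> {3..r} = ?D \<union> (?P \<union> ?P')"
    by (auto simp: index_pairs_def image_iff)
  have "(\<Sum>k\<in>{3..r}. \<Sum>l\<in>{3..r}. g k l) = (\<Sum>(k, l)\<in>?D \<union> (?P \<union> ?P'). g k l)"
    by (simp add: sum.cartesian_product union[symmetric])
  also have "\<dots> = (\<Sum>(k, l)\<in>?D. g k l) + ((\<Sum>(k, l)\<in>?P. g k l) + (\<Sum>(k, l)\<in>?P'. g k l))"
  proof -
    have "?P \<inter> ?P' = {}" "?D \<inter> (?P \<union> ?P') = {}" by (auto simp: index_pairs_def)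
    then show ?thesis using fin by (simp add: sum.union_disjoint)
  qed
  also have "(\<Sum>(k, l)\<in>?D. g k l) = (\<Sum>k\<in>{3..r}. g k k)"
    by (subst sum.reindex) (auto simp: inj_on_def)
  also have "(\<Sum>(k, l)\<in>?P'. g k l) = (\<Sum>(k, l)\<in>?P. g k l)"
    by (subst sum.reindex) (auto simp: sym intro!: sum.cong)
  finally show ?thesis by (simp add: case_prod_beta sum_distrib_left)
qed

context link_pattern
begin

lemma T_swap: "(\<Sum>i\<in>I. x i * (\<Sum>j\<in>I. T i j * y j)) = (\<Sum>i\<in>I. y i * (\<Sum>j\<in>I. T i j * x j))"
proof -
  have "(\<Sum>i\<in>I. x i * (\<Sum>j\<in>I. T i j * y j)) = (\<Sum>j\<in>I. \<Sum>i\<in>I. x i * (T i j * y j))"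
    by (subst sum.swap) (simp add: sum_distrib_left)
  also have "\<dots> = (\<Sum>i\<in>I. y i * (\<Sum>j\<in>I. T i j * x j))"
    unfolding sum_distrib_left by (intro sum.cong refl) (simp add: T_sym mult_ac)
  finally show ?thesis .
qed

text \<open>
  The mixed terms are collected by the symmetry of \<open>T\<close>, which replaces \<open>T v\<close> by \<open>w\<close> everywhere.
\<close>

lemma T_form_expand:
  assumes w: "\<forall>i\<in>I. (\<Sum>j\<in>I. T i j * v j) = w i"
  shows "(\<Sum>i\<in>I. \<Sum>j\<in>I. (u i - s - v i) * T i j * (u j - s - v j)) =
    (\<Sum>i\<in>I. \<Sum>j\<in>I. u i * T i j * u j) - 2 * s * (\<Sum>i\<in>I. (\<Sum>j\<in>I. T i j) * u i)
    - 2 * (\<Sum>i\<in>I. u i * w i) + s\<^sup>2 * (\<Sum>i\<in>I. \<Sum>j\<in>I. T i j)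
    + 2 * s * (\<Sum>i\<in>I. w i) + (\<Sum>i\<in>I. v i * w i)"
proof -
  define t where "t = (\<lambda>i. \<Sum>j\<in>I. T i j)"
  define z where "z = (\<lambda>i. \<Sum>j\<in>I. T i j * u j)"
  have "(\<Sum>i\<in>I. \<Sum>j\<in>I. (u i - s - v i) * T i j * (u j - s - v j)) =
    (\<Sum>i\<in>I. (u i - s - v i) * (z i - s * t i - w i))"
  proof (intro sum.cong refl)
    fix i assume "i \<in> I"
    have "(\<Sum>j\<in>I. T i j * (u j - s - v j)) = z i - s * t i - w i"
    proof -
      have "(\<Sum>j\<in>I. T i j * (u j - s - v j)) = (\<Sum>j\<in>I. T i j * u j - s * T i j - T i j * v j)"
        by (intro sum.cong refl) (simp add: algebra_simps)
      then show ?thesis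
        by (simp add: sum_subtractf z_def t_def bspec[OF w \<open>i \<in> I\<close>] flip: sum_distrib_left)
    qed
    then show "(\<Sum>j\<in>I. (u i - s - v i) * T i j * (u j - s - v j)) = (u i - s - v i) * (z i - s * t i - w i)"
      by (simp only: mult.assoc flip: sum_distrib_left)
  qed
  also have "\<dots> = (\<Sum>i\<in>I. u i * z i) - s * (\<Sum>i\<in>I. t i * u i) - (\<Sum>i\<in>I. u i * w i)
     - s * (\<Sum>i\<in>I. z i) + s\<^sup>2 * (\<Sum>i\<in>I. t i) + s * (\<Sum>i\<in>I. w i)
     - (\<Sum>i\<in>I. v i * z i) + s * (\<Sum>i\<in>I. v i * t i) + (\<Sum>i\<in>I. v i * w i)"
    unfolding sum_distrib_left sum_subtractf[symmetric] sum.distrib[symmetric]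
    by (intro sum.cong refl) (simp add: algebra_simps power2_eq_square)
  also have "(\<Sum>i\<in>I. u i * z i) = (\<Sum>i\<in>I. \<Sum>j\<in>I. u i * T i j * u j)"
    by (simp add: z_def sum_distrib_left mult.assoc)
  also have "(\<Sum>i\<in>I. z i) = (\<Sum>i\<in>I. t i * u i)"
    using T_swap[of "\<lambda>_. 1" u] by (simp add: z_def t_def mult.commute)
  also have "(\<Sum>i\<in>I. v i * z i) = (\<Sum>i\<in>I. u i * w i)"
    using T_swap[of v u] w by (simp add: z_def)
  also have "(\<Sum>i\<in>I. v i * t i) = (\<Sum>i\<in>I. w i)"
    using T_swap[of v "\<lambda>_. 1"] w by (simp add: t_def)
  finally show ?thesis by (simp add: t_def)
qed

lemma B_A_swap: "i \<in> I \<Longrightarrow> (\<Sum>j\<in>I. T i j * (\<Sum>k\<in>I. A j k * x k)) = (\<Sum>k\<in>I. B i k * x k)"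
proof -
  assume "i \<in> I"
  have "(\<Sum>j\<in>I. T i j * (\<Sum>k\<in>I. A j k * x k)) = (\<Sum>k\<in>I. \<Sum>j\<in>I. T i j * (A j k * x k))"
    by (subst sum.swap) (simp add: sum_distrib_left)
  also have "\<dots> = (\<Sum>k\<in>I. B i k * x k)"
    using \<open>i \<in> I\<close> by (simp add: T_A[symmetric] sum_distrib_right mult.assoc)
  finally show ?thesis .
qed

lemma NN_form: "(\<Sum>i\<in>I. (\<Sum>k\<in>I. A i k * x k) * (\<Sum>l\<in>I. B i l * x l)) = (\<Sum>k\<in>I. \<Sum>l\<in>I. NN k l * (x k * x l))"
proof -
  have "(\<Sum>i\<in>I. (\<Sum>k\<in>I. A i k * x k) * (\<Sum>l\<in>I. B i l * x l)) =
    (\<Sum>i\<in>I. \<Sum>k\<in>I. \<Sum>l\<in>I. A i k * B i l * (x k * x l))"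
    unfolding sum_product by (intro sum.cong refl) (simp add: mult_ac)
  also have "\<dots> = (\<Sum>k\<in>I. \<Sum>i\<in>I. \<Sum>l\<in>I. A i k * B i l * (x k * x l))" by (rule sum.swap)
  also have "\<dots> = (\<Sum>k\<in>I. \<Sum>l\<in>I. \<Sum>i\<in>I. A i k * B i l * (x k * x l))"
    by (rule sum.cong[OF refl]) (rule sum.swap)
  finally show ?thesis by (simp add: NN_def sum_distrib_right)
qed

end

section \<open>The stress on the graph\<close>

lemma card_increasing_pairs: "card {(i, j). 1 \<le> i \<and> i < j \<and> j \<le> r} = r * (r - 1) div 2"
proof -
  have "card {(i, j). 1 \<le> i \<and> i < j \<and> j \<le> r} = card (SIGMA j:{1..r}. {1..<j})"
    by (rule bij_betw_same_card[of prod.swap]) (auto simp: bij_betw_def inj_on_def image_iff)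
  also have "\<dots> = (\<Sum>j\<in>{1..r}. j - 1)" by (simp add: card_SigmaI)
  also have "\<dots> = r * (r - 1) div 2"
  proof -
    have "2 * (\<Sum>j\<in>{1..r}. j - 1) = r * (r - 1)"
    proof (induction r)
      case (Suc m)
      then show ?case by (cases m) auto
    qed simp
    then show ?thesis by simp
  qed
  finally show ?thesis .
qed

locale H_graph =
  fixes r n :: nat and c :: "nat \<Rightarrow> nat \<Rightarrow> node set" and f :: "node \<Rightarrow> nat"
  assumes r: "3 \<le> r"
    and chosen: "\<And>i j. (i, j) \<in> index_pairs r \<Longrightarrow> c i j \<in> link_edges i j"
    and f: "bij_betw f (H_nodes r) {0..<n}"
begin

abbreviation V where "V \<equiv> H_nodes r"
abbreviation E where "E \<equiv> H_edges r c"
abbreviation F where "F \<equiv> (\<lambda>e. f ` e) ` E"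

lemma V_eq: "V = N ` {1..r} \<union> (\<lambda>(i, j). M i j) ` {(i, j). 1 \<le> i \<and> i < j \<and> j \<le> r}" (is "_ = ?W")
proof
  show "V \<subseteq> ?W" using r by (auto simp: H_nodes_def H3_nodes_def index_pairs_def image_iff)
  show "?W \<subseteq> V"
  proof
    fix v assume "v \<in> ?W"
    then consider (N) i where "v = N i" "1 \<le> i" "i \<le> r" | (M) i j where "v = M i j" "1 \<le> i" "i < j" "j \<le> r"
      by auto
    then show "v \<in> V"
    proof cases
      case N
      have "v \<in> H3_nodes (max 3 i)" using N by (cases "i = 1 \<or> i = 2") (auto simp: H3_nodes_def max_def)
      then show ?thesis using N r by (auto simp: H_nodes_def)
    next
      case M
      show ?thesis
      proof (cases "3 \<le> i")
        case True
        then show ?thesis using M by (auto simp: H_nodes_def index_pairs_def)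
      next
        case False
        then have "i = 1 \<or> i = 2" using M by auto
        then have "v \<in> H3_nodes (max 3 j)" using M by (auto simp: H3_nodes_def max_def)
        then show ?thesis using M r by (auto simp: H_nodes_def)
      qed
    qed
  qed
qed

lemma N_in_V: "N i \<in> V \<longleftrightarrow> 1 \<le> i \<and> i \<le> r"
  by (auto simp: V_eq)

lemma M_in_V: "M i j \<in> V \<longleftrightarrow> 1 \<le> i \<and> i < j \<and> j \<le> r"
  by (auto simp: V_eq)

lemma n_eq: "n = r * (r + 1) div 2"
proof -
  let ?P = "{(i, j). 1 \<le> i \<and> i < j \<and> j \<le> r}"
  have fin: "finite ?P" by (rule finite_subset[of _ "{..r} \<times> {..r}"]) auto
  have "n = card V" using bij_betw_same_card[OF f] by simp
  also have "\<dots> = card (N ` {1..r}) + card ((\<lambda>(i, j). M i j) ` ?P)"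
    unfolding V_eq using fin by (intro card_Un_disjoint) auto
  also have "\<dots> = r + card ?P" by (simp add: card_image inj_on_def)
  also have "\<dots> = r * (r + 1) div 2"
  proof -
    have "r * (r + 1) = r * (r - 1) + r * 2" by (cases r) auto
    then show ?thesis unfolding card_increasing_pairs by simp
  qed
  finally show ?thesis .
qed

lemma edge_subset: "e \<in> E \<Longrightarrow> e \<subseteq> V \<and> card e = 2"
proof -
  assume "e \<in> E"
  then consider (H3) i where "3 \<le> i" "i \<le> r" "e \<in> H3_edges i"
    | (P) i j where "(i, j) \<in> index_pairs r" "e \<in> {{N i, M i j}, {N j, M i j}, c i j}"
    unfolding H_edges_def by fastforce
  then show ?thesis
  proof cases
    case H3
    then show ?thesis unfolding H3_edges_def insert_iff empty_iff
      by (elim disjE FalseE) (simp_all add: N_in_V M_in_V)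
  next
    case P
    have "1 \<le> i \<and> i \<le> r \<and> 1 \<le> j \<and> j \<le> r \<and> i < j \<and> 1 < i \<and> 1 < j"
      using P(1) by (auto simp: index_pairs_def)
    moreover have "e \<in> {{N i, M i j}, {N j, M i j}, {N i, N j}, {N i, M 1 j}, {N j, M 1 i}, {M 1 i, M 1 j}}"
      using P(2) chosen[OF P(1)] unfolding link_edges_def insert_iff empty_iff
      by (elim disjE FalseE) (simp_all only: simp_thms)
    ultimately show ?thesis unfolding insert_iff empty_iff
      by (elim disjE FalseE) (simp_all add: N_in_V M_in_V)
  qed
qed

lemma edge_nodes:
  assumes "{u, v} \<in> E"
  shows "u \<in> V" and "v \<in> V" and "u \<noteq> v"
  using edge_subset[OF assms] by auto

lemma H3_edge: "3 \<le> i \<Longrightarrow> i \<le> r \<Longrightarrow> e \<in> H3_edges i \<Longrightarrow> e \<in> E"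
  by (auto simp: H_edges_def)

lemma pair_edge:
  assumes "(i, j) \<in> index_pairs r"
  shows "{N i, M i j} \<in> E" and "{N j, M i j} \<in> E" and "c i j \<in> E"
  using assms by (auto simp: H_edges_def)

text \<open>
  \<open>linkM\<close> marks the pairs whose chosen edge joins \<open>v\<^sub>1\<^sub>i\<close> and \<open>v\<^sub>1\<^sub>j\<close>, and \<open>linkN i k\<close> those whose chosen edge
  joins \<open>v\<^sub>1\<^sub>i\<close> and \<open>v\<^sub>k\<close>. The edges between \<open>v\<^sub>i\<close> and \<open>v\<^sub>1\<^sub>i\<close>, which are always present, are left out.
\<close>

definition linkM :: "nat \<Rightarrow> nat \<Rightarrow> real" where
  "linkM i j = (if i \<noteq> j \<and> {M 1 i, M 1 j} \<in> E then 1 else 0)"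

definition linkN :: "nat \<Rightarrow> nat \<Rightarrow> real" where
  "linkN i k = (if i \<noteq> k \<and> {M 1 i, N k} \<in> E then 1 else 0)"

sublocale link_pattern "{3..r}" linkM linkN
  by unfold_locales (use r in \<open>auto simp: linkM_def linkN_def insert_commute\<close>)

text \<open>
  Edge forms written in terms of the nodes of \<open>H\<^sub>r\<close> instead of their numbers.
\<close>

definition node_form :: "((node \<Rightarrow> real) \<Rightarrow> real) \<Rightarrow> bool" where
  "node_form Q \<longleftrightarrow> edge_form n F (\<lambda>y. Q (\<lambda>v. y (f v)))"

lemma node_form_add: "node_form P \<Longrightarrow> node_form Q \<Longrightarrow> node_form (\<lambda>z. P z + Q z)"
  unfolding node_form_def by (rule edge_form_add)

lemma node_form_diff: "node_form P \<Longrightarrow> node_form Q \<Longrightarrow> node_form (\<lambda>z. P z - Q z)"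
  unfolding node_form_def by (rule edge_form_diff)

lemma node_form_mult: "node_form Q \<Longrightarrow> node_form (\<lambda>z. a * Q z)"
  unfolding node_form_def by (rule edge_form_mult)

lemma node_form_sum: "(\<And>a. a \<in> S \<Longrightarrow> node_form (Q a)) \<Longrightarrow> node_form (\<lambda>z. \<Sum>a\<in>S. Q a z)"
  unfolding node_form_def by (rule edge_form_sum)

lemma node_form_square: "v \<in> V \<Longrightarrow> node_form (\<lambda>z. (z v)\<^sup>2)"
  unfolding node_form_def using bij_betwE[OF f] by (intro edge_form_square) auto

lemma node_form_edge:
  assumes "{u, v} \<in> E"
  shows "node_form (\<lambda>z. z u * z v)"
  unfolding node_form_def
proof (rule edge_form_edge)
  note uv = edge_nodes[OF assms]
  show "f u < n" "f v < n" using bij_betwE[OF f] uv by auto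
  show "f u \<noteq> f v" using bij_betw_imp_inj_on[OF f] uv by (auto dest: inj_onD)
  have "{f u, f v} = f ` {u, v}" by simp
  then show "{f u, f v} \<in> F" using assms by blast
qed

lemmas node_form_intros =
  node_form_add node_form_diff node_form_mult node_form_sum node_form_square node_form_edge

text \<open>
  The length of \<open>e\<^sub>1 + e\<^sub>2 + \<Sum>\<^sub>k A\<^sub>i\<^sub>k e\<^sub>k\<close>, the vector of \<open>v\<^sub>1\<^sub>i\<close> before normalization.
\<close>

definition apex_norm :: "nat \<Rightarrow> real" where
  "apex_norm i = sqrt (2 + (\<Sum>k\<in>{3..r}. (A i k)\<^sup>2))"

text \<open>
  In every coordinate this vanishes iff the vector of \<open>v\<^sub>1\<^sub>i\<close> is \<open>e\<^sub>1 + e\<^sub>2 + \<Sum>\<^sub>k A\<^sub>i\<^sub>k e\<^sub>k\<close>, normalized,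
  where \<open>e\<^sub>k\<close> is the vector of \<open>v\<^sub>k\<close>. For \<open>A = 1\<close> it is the linear dependence of the four nodes of a complete graph \<open>K\<^sub>4\<close>.
\<close>

definition K4_relation :: "nat \<Rightarrow> (node \<Rightarrow> real) \<Rightarrow> real" where
  "K4_relation i z = apex_norm i * z (M 1 i) - (z (N 1) + z (N 2)) - (\<Sum>k\<in>{3..r}. A i k * z (N k))"

text \<open>
  In every coordinate this vanishes iff the vector of the subdividing node \<open>v\<^sub>a\<^sub>b\<close> is \<open>(v\<^sub>a - v\<^sub>b) / \<surd>2\<close>. In its
  square the term at \<open>z (N a) * z (N b)\<close> is negative, so that it can cancel a positive one.
\<close>

definition path_relation :: "nat \<Rightarrow> nat \<Rightarrow> (node \<Rightarrow> real) \<Rightarrow> real" where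
  "path_relation a b z = sqrt 2 * z (M a b) - z (N a) + z (N b)"

text \<open>
  \<open>NN k l\<close> is the amount needed to cancel the term at the pair \<open>v\<^sub>k, v\<^sub>l\<close>. If this pair is an edge, no
  cancellation is needed, but \<open>NN k l\<close> may be zero; then the weight is increased to keep it positive.
\<close>

definition path_weight :: "nat \<Rightarrow> nat \<Rightarrow> real" where
  "path_weight k l = NN k l + (if {N k, N l} \<in> E then 1 else 0)"

text \<open>
  The stress certifying optimality: the form of \<open>T\<close> at the relations of the \<open>K\<^sub>4\<close>'s, plus squares of the
  relations at the paths. Its kernel is \<open>r\<close>-dimensional, and the path weights are those that cancel
  all products of nonadjacent nodes.
\<close>

definition Q :: "(node \<Rightarrow> real) \<Rightarrow> real" where
  "Q z = (\<Sum>i\<in>{3..r}. \<Sum>j\<in>{3..r}. K4_relation i z * T i j * K4_relation j z)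
    + (\<Sum>i\<in>{3..r}. \<Sum>j\<in>{3..r}. T i j) * (path_relation 1 2 z)\<^sup>2
    + (\<Sum>k\<in>{3..r}. (\<Sum>i\<in>{3..r}. B i k) * (path_relation 2 k z)\<^sup>2)
    + (\<Sum>(k, l)\<in>index_pairs r. path_weight k l * (path_relation k l z)\<^sup>2)"

lemma path_relation_square:
  "(path_relation a b z)\<^sup>2 = 2 * (z (M a b))\<^sup>2 + (z (N a))\<^sup>2 + (z (N b))\<^sup>2
    - 2 * sqrt 2 * (z (N a) * z (M a b)) + 2 * sqrt 2 * (z (N b) * z (M a b)) - 2 * z (N a) * z (N b)"
proof -
  have "(s * m - a + b)\<^sup>2 = s\<^sup>2 * m\<^sup>2 + a\<^sup>2 + b\<^sup>2 - 2 * s * (a * m) + 2 * s * (b * m) - 2 * a * b"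
    for s m a b :: real
    by (simp add: power2_eq_square algebra_simps)
  from this[of "sqrt 2" "z (M a b)" "z (N a)" "z (N b)"] show ?thesis
    by (simp add: path_relation_def)
qed

text \<open>
  The terms are grouped such that each group is supported on the edges. The groups that combine a
  path relation with another term are those where a cancellation takes place.
\<close>

lemma Q_expand:
  "Q z = (\<Sum>i\<in>{3..r}. \<Sum>j\<in>{3..r}. (apex_norm i * T i j * apex_norm j) * (z (M 1 i) * z (M 1 j)))
    - (\<Sum>i\<in>{3..r}. (2 * (\<Sum>j\<in>{3..r}. T i j) * apex_norm i) * (z (N 1) * z (M 1 i) + z (N 2) * z (M 1 i)))
    - (\<Sum>i\<in>{3..r}. \<Sum>k\<in>{3..r}. (2 * apex_norm i * B i k) * (z (M 1 i) * z (N k)))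
    + (\<Sum>i\<in>{3..r}. \<Sum>j\<in>{3..r}. T i j) * ((path_relation 1 2 z)\<^sup>2 + (z (N 1) + z (N 2))\<^sup>2)
    + (\<Sum>k\<in>{3..r}. (\<Sum>i\<in>{3..r}. B i k) * ((path_relation 2 k z)\<^sup>2 + 2 * (z (N 1) + z (N 2)) * z (N k)))
    + (\<Sum>k\<in>{3..r}. NN k k * (z (N k))\<^sup>2)
    + (\<Sum>(k, l)\<in>index_pairs r. path_weight k l * (path_relation k l z)\<^sup>2 + 2 * NN k l * (z (N k) * z (N l)))"
proof -
  let ?I = "{3..r}"
  define s where "s = z (N 1) + z (N 2)"
  define u where "u = (\<lambda>i. apex_norm i * z (M 1 i))"
  define v where "v = (\<lambda>i. \<Sum>k\<in>?I. A i k * z (N k))"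
  define w where "w = (\<lambda>i. \<Sum>k\<in>?I. B i k * z (N k))"
  have Tv: "\<forall>i\<in>?I. (\<Sum>j\<in>?I. T i j * v j) = w i"
    unfolding v_def w_def by (intro ballI B_A_swap)
  have K4: "(\<Sum>i\<in>?I. \<Sum>j\<in>?I. K4_relation i z * T i j * K4_relation j z) =
      (\<Sum>i\<in>?I. \<Sum>j\<in>?I. (u i - s - v i) * T i j * (u j - s - v j))"
    by (simp add: K4_relation_def u_def s_def v_def)
  note expand = T_form_expand[of v w u s, OF Tv]
  have uu: "(\<Sum>i\<in>?I. \<Sum>j\<in>?I. u i * T i j * u j) =
      (\<Sum>i\<in>?I. \<Sum>j\<in>?I. (apex_norm i * T i j * apex_norm j) * (z (M 1 i) * z (M 1 j)))"
    by (simp add: u_def mult_ac)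
  have su: "2 * s * (\<Sum>i\<in>?I. (\<Sum>j\<in>?I. T i j) * u i) =
      (\<Sum>i\<in>?I. (2 * (\<Sum>j\<in>?I. T i j) * apex_norm i) * (z (N 1) * z (M 1 i) + z (N 2) * z (M 1 i)))"
    unfolding sum_distrib_left[of "2 * s"] by (intro sum.cong refl) (simp add: u_def s_def algebra_simps)
  have uw: "2 * (\<Sum>i\<in>?I. u i * w i) = (\<Sum>i\<in>?I. \<Sum>k\<in>?I. (2 * apex_norm i * B i k) * (z (M 1 i) * z (N k)))"
    by (simp add: u_def w_def sum_distrib_left mult_ac)
  have sw: "2 * s * (\<Sum>i\<in>?I. w i) = (\<Sum>k\<in>?I. (\<Sum>i\<in>?I. B i k) * (2 * s * z (N k)))"
  proof -
    have "(\<Sum>i\<in>?I. w i) = (\<Sum>k\<in>?I. \<Sum>i\<in>?I. B i k * z (N k))" unfolding w_def by (rule sum.swap)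
    then show ?thesis by (simp add: sum_distrib_left sum_distrib_right mult_ac)
  qed
  have vw: "(\<Sum>i\<in>?I. v i * w i) = (\<Sum>k\<in>?I. NN k k * (z (N k))\<^sup>2)
      + (\<Sum>(k, l)\<in>index_pairs r. 2 * NN k l * (z (N k) * z (N l)))"
    unfolding v_def w_def NN_form
    by (subst sum_square_split) (simp_all add: NN_sym mult_ac power2_eq_square)
  show ?thesis
    unfolding Q_def K4 expand uu su uw sw vw
    by (simp add: s_def case_prod_beta distrib_left sum.distrib)
qed

lemma node_form_Q: "node_form Q"
proof -
  have I: "3 \<le> i \<and> i \<le> r" if "i \<in> {3..r}" for i using that by simp
  have E3: "{N 1, M 1 2} \<in> E" "{N 2, M 1 2} \<in> E"
    using r by (auto intro!: H3_edge[of 3] simp: H3_edges_def)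
  have Ei: "{N 2, M 2 i} \<in> E" "{N i, M 2 i} \<in> E" "{N 1, N i} \<in> E" "{N 1, M 1 i} \<in> E"
    "{N 2, M 1 i} \<in> E" "{M 1 i, N i} \<in> E" if "i \<in> {3..r}" for i
    using I[OF that] by (auto intro!: H3_edge[of i] simp: H3_edges_def)
  have NV: "N i \<in> V" if "i \<in> {1, 2} \<union> {3..r}" for i using that r by (auto simp: N_in_V)
  have 1: "node_form (\<lambda>z. (apex_norm i * T i j * apex_norm j) * (z (M 1 i) * z (M 1 j)))"
    if "i \<in> {3..r}" "j \<in> {3..r}" for i j
  proof (cases "i = j")
    case True
    have "node_form (\<lambda>z. (z (M 1 i))\<^sup>2)" using that by (intro node_form_square) (simp add: M_in_V)
    then show ?thesis using True node_form_mult by (simp add: power2_eq_square)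
  next
    case False
    show ?thesis
    proof (cases "{M 1 i, M 1 j} \<in> E")
      case True
      then show ?thesis by (intro node_form_intros)
    next
      case False
      then have "T i j = 0" using \<open>i \<noteq> j\<close> by (simp add: T_def linkM_def)
      then show ?thesis using node_form_mult[OF node_form_square[OF NV[of 1]], of 0] by simp
    qed
  qed
  have 2: "node_form (\<lambda>z. (2 * apex_norm i * B i k) * (z (M 1 i) * z (N k)))"
    if "i \<in> {3..r}" "k \<in> {3..r}" for i k
  proof (cases "{M 1 i, N k} \<in> E")
    case True
    then show ?thesis by (intro node_form_intros)
  next
    case False
    then have "i \<noteq> k" using Ei[OF that(1)] by auto
    then have "B i k = 0" using False by (simp add: B_def linkN_def)
    then show ?thesis using node_form_mult[OF node_form_square[OF NV[of 1]], of 0] by simp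
  qed
  have 3: "node_form (\<lambda>z. (path_relation 1 2 z)\<^sup>2 + (z (N 1) + z (N 2))\<^sup>2)"
  proof -
    have "node_form (\<lambda>z. 2 * (z (M 1 2))\<^sup>2 + 2 * (z (N 1))\<^sup>2 + 2 * (z (N 2))\<^sup>2
      - (2 * sqrt 2) * (z (N 1) * z (M 1 2)) + (2 * sqrt 2) * (z (N 2) * z (M 1 2)))"
      by (intro node_form_intros E3 NV) (use r in \<open>auto simp: M_in_V\<close>)
    then show ?thesis
      unfolding path_relation_square by (simp add: power2_sum algebra_simps)
  qed
  have 4: "node_form (\<lambda>z. (path_relation 2 k z)\<^sup>2 + 2 * (z (N 1) + z (N 2)) * z (N k))"
    if "k \<in> {3..r}" for k
  proof -
    have "node_form (\<lambda>z. 2 * (z (M 2 k))\<^sup>2 + (z (N 2))\<^sup>2 + (z (N k))\<^sup>2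
      - (2 * sqrt 2) * (z (N 2) * z (M 2 k)) + (2 * sqrt 2) * (z (N k) * z (M 2 k)) + 2 * (z (N 1) * z (N k)))"
      by (intro node_form_intros Ei NV that) (use that in \<open>auto simp: M_in_V\<close>)
    then show ?thesis
      unfolding path_relation_square by (simp add: algebra_simps)
  qed
  have 5: "node_form (\<lambda>z. path_weight k l * (path_relation k l z)\<^sup>2 + 2 * NN k l * (z (N k) * z (N l)))"
    if kl: "(k, l) \<in> index_pairs r" for k l
  proof -
    have V: "N k \<in> V" "N l \<in> V" "M k l \<in> V" using kl by (auto simp: index_pairs_def N_in_V M_in_V)
    have P: "node_form (\<lambda>z. path_weight k l * (2 * (z (M k l))\<^sup>2 + (z (N k))\<^sup>2 + (z (N l))\<^sup>2
      - (2 * sqrt 2) * (z (N k) * z (M k l)) + (2 * sqrt 2) * (z (N l) * z (M k l))))"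
      by (intro node_form_intros pair_edge[OF kl] V)
    have R: "node_form (\<lambda>z. (path_weight k l - NN k l) * (2 * (z (N k) * z (N l))))"
    proof (cases "{N k, N l} \<in> E")
      case True
      then show ?thesis by (intro node_form_intros)
    next
      case False
      then show ?thesis
        using node_form_mult[OF node_form_square[OF NV[of 1]], of 0] by (simp add: path_weight_def)
    qed
    show ?thesis
      using node_form_diff[OF P R] unfolding path_relation_square by (simp add: algebra_simps)
  qed
  have "node_form (\<lambda>z. (\<Sum>i\<in>{3..r}. \<Sum>j\<in>{3..r}. (apex_norm i * T i j * apex_norm j) * (z (M 1 i) * z (M 1 j)))
    - (\<Sum>i\<in>{3..r}. (2 * (\<Sum>j\<in>{3..r}. T i j) * apex_norm i) * (z (N 1) * z (M 1 i) + z (N 2) * z (M 1 i)))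
    - (\<Sum>i\<in>{3..r}. \<Sum>k\<in>{3..r}. (2 * apex_norm i * B i k) * (z (M 1 i) * z (N k)))
    + (\<Sum>i\<in>{3..r}. \<Sum>j\<in>{3..r}. T i j) * ((path_relation 1 2 z)\<^sup>2 + (z (N 1) + z (N 2))\<^sup>2)
    + (\<Sum>k\<in>{3..r}. (\<Sum>i\<in>{3..r}. B i k) * ((path_relation 2 k z)\<^sup>2 + 2 * (z (N 1) + z (N 2)) * z (N k)))
    + (\<Sum>k\<in>{3..r}. NN k k * (z (N k))\<^sup>2)
    + (\<Sum>p\<in>index_pairs r. path_weight (fst p) (snd p) * (path_relation (fst p) (snd p) z)\<^sup>2
        + 2 * NN (fst p) (snd p) * (z (N (fst p)) * z (N (snd p)))))"
  proof (intro node_form_add node_form_diff)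
    show "node_form (\<lambda>z. \<Sum>i\<in>{3..r}. \<Sum>j\<in>{3..r}. (apex_norm i * T i j * apex_norm j) * (z (M 1 i) * z (M 1 j)))"
      by (intro node_form_sum 1)
    show "node_form (\<lambda>z. \<Sum>i\<in>{3..r}. (2 * (\<Sum>j\<in>{3..r}. T i j) * apex_norm i)
        * (z (N 1) * z (M 1 i) + z (N 2) * z (M 1 i)))"
      by (intro node_form_sum node_form_mult node_form_add node_form_edge Ei)
    show "node_form (\<lambda>z. \<Sum>i\<in>{3..r}. \<Sum>k\<in>{3..r}. (2 * apex_norm i * B i k) * (z (M 1 i) * z (N k)))"
      by (intro node_form_sum 2)
    show "node_form (\<lambda>z. (\<Sum>i\<in>{3..r}. \<Sum>j\<in>{3..r}. T i j) * ((path_relation 1 2 z)\<^sup>2 + (z (N 1) + z (N 2))\<^sup>2))"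
      by (intro node_form_mult 3)
    show "node_form (\<lambda>z. \<Sum>k\<in>{3..r}. (\<Sum>i\<in>{3..r}. B i k)
        * ((path_relation 2 k z)\<^sup>2 + 2 * (z (N 1) + z (N 2)) * z (N k)))"
      by (intro node_form_sum node_form_mult 4)
    show "node_form (\<lambda>z. \<Sum>k\<in>{3..r}. NN k k * (z (N k))\<^sup>2)"
      by (intro node_form_sum node_form_mult node_form_square NV) simp
    show "node_form (\<lambda>z. \<Sum>p\<in>index_pairs r. path_weight (fst p) (snd p) * (path_relation (fst p) (snd p) z)\<^sup>2
        + 2 * NN (fst p) (snd p) * (z (N (fst p)) * z (N (snd p))))"
      by (intro node_form_sum 5) simp
  qed
  then show ?thesis unfolding Q_expand[abs_def] case_prod_beta .
qed

text \<open>
  Unless \<open>v\<^sub>k v\<^sub>l\<close> is an edge, the edge chosen for the pair contributes to \<open>linkM\<close> or \<open>linkN\<close>.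
\<close>

lemma path_weight_pos:
  assumes "(k, l) \<in> index_pairs r"
  shows "0 < path_weight k l"
proof (cases "{N k, N l} \<in> E")
  case True
  then show ?thesis using NN_nonneg[of k l] by (simp add: path_weight_def)
next
  case False
  have kl: "k \<in> {3..r}" "l \<in> {3..r}" "k \<noteq> l" using assms by (auto simp: index_pairs_def)
  have "c k l \<in> E" "c k l \<in> link_edges k l" using pair_edge(3)[OF assms] chosen[OF assms] by auto
  then have "{N k, M 1 l} \<in> E \<or> {N l, M 1 k} \<in> E \<or> {M 1 k, M 1 l} \<in> E"
    using False unfolding link_edges_def insert_iff empty_iff
    by (elim disjE FalseE) (simp_all only: simp_thms)
  then have "linkM k l = 1 \<or> linkN k l = 1 \<or> linkN l k = 1"
    using kl by (auto simp: linkM_def linkN_def insert_commute)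
  then show ?thesis using NN_pos[OF kl] NN_nonneg[of k l] by (simp add: path_weight_def)
qed

lemma finite_index_pairs: "finite (index_pairs r)"
  by (rule finite_subset[of _ "{3..r} \<times> {3..r}"]) (auto simp: index_pairs_def)

lemma Q_parts_nonneg:
  "0 \<le> (\<Sum>i\<in>{3..r}. \<Sum>j\<in>{3..r}. K4_relation i z * T i j * K4_relation j z)"
  "0 \<le> (\<Sum>i\<in>{3..r}. \<Sum>j\<in>{3..r}. T i j) * (path_relation 1 2 z)\<^sup>2"
  "0 \<le> (\<Sum>k\<in>{3..r}. (\<Sum>i\<in>{3..r}. B i k) * (path_relation 2 k z)\<^sup>2)"
  "0 \<le> (\<Sum>(k, l)\<in>index_pairs r. path_weight k l * (path_relation k l z)\<^sup>2)"
proof -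
  show "0 \<le> (\<Sum>i\<in>{3..r}. \<Sum>j\<in>{3..r}. K4_relation i z * T i j * K4_relation j z)"
    by (rule T_form_nonneg)
  show "0 \<le> (\<Sum>i\<in>{3..r}. \<Sum>j\<in>{3..r}. T i j) * (path_relation 1 2 z)\<^sup>2"
    using T_total_pos by simp
  show "0 \<le> (\<Sum>k\<in>{3..r}. (\<Sum>i\<in>{3..r}. B i k) * (path_relation 2 k z)\<^sup>2)"
    using B_nonneg by (intro sum_nonneg mult_nonneg_nonneg) auto
  show "0 \<le> (\<Sum>(k, l)\<in>index_pairs r. path_weight k l * (path_relation k l z)\<^sup>2)"
    using path_weight_pos by (intro sum_nonneg) (auto simp: less_imp_le)
qed

lemma Q_nonneg: "0 \<le> Q z"
  unfolding Q_def by (intro add_nonneg_nonneg Q_parts_nonneg)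

lemma Q_eq_0_imp:
  assumes "Q z = 0"
  shows "i \<in> {3..r} \<Longrightarrow> K4_relation i z = 0"
    and "path_relation 1 2 z = 0"
    and "k \<in> {3..r} \<Longrightarrow> path_relation 2 k z = 0"
    and "(k, l) \<in> index_pairs r \<Longrightarrow> path_relation k l z = 0"
proof -
  note parts = Q_parts_nonneg[of z]
  have 1: "(\<Sum>i\<in>{3..r}. \<Sum>j\<in>{3..r}. K4_relation i z * T i j * K4_relation j z) = 0"
    and 2: "(\<Sum>i\<in>{3..r}. \<Sum>j\<in>{3..r}. T i j) * (path_relation 1 2 z)\<^sup>2 = 0"
    and 3: "(\<Sum>k\<in>{3..r}. (\<Sum>i\<in>{3..r}. B i k) * (path_relation 2 k z)\<^sup>2) = 0"
    and 4: "(\<Sum>p\<in>index_pairs r. path_weight (fst p) (snd p) * (path_relation (fst p) (snd p) z)\<^sup>2) = 0"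
    using assms parts unfolding Q_def case_prod_beta by linarith+
  show "i \<in> {3..r} \<Longrightarrow> K4_relation i z = 0" by (rule T_form_eq_0[OF 1])
  show "path_relation 1 2 z = 0" using 2 T_total_pos by simp
  show "path_relation 2 k z = 0" if k: "k \<in> {3..r}"
  proof -
    have "\<forall>k\<in>{3..r}. (\<Sum>i\<in>{3..r}. B i k) * (path_relation 2 k z)\<^sup>2 = 0"
      using 3 B_nonneg by (subst (asm) sum_nonneg_eq_0_iff) (auto intro!: mult_nonneg_nonneg sum_nonneg)
    then show ?thesis using k B_column_pos[OF k] by fastforce
  qed
  show "path_relation k l z = 0" if kl: "(k, l) \<in> index_pairs r"
  proof -
    have "\<forall>p\<in>index_pairs r. path_weight (fst p) (snd p) * (path_relation (fst p) (snd p) z)\<^sup>2 = 0"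
      using 4 path_weight_pos finite_index_pairs
      by (subst (asm) sum_nonneg_eq_0_iff) (auto simp: less_imp_le)
    then show ?thesis using kl path_weight_pos[OF kl] by fastforce
  qed
qed

end

section \<open>The vector configuration and the extreme Gram dimension\<close>

context H_graph
begin

text \<open>
  The \<open>k\<close>-th coordinate of the vector of a node: unit vectors at the nodes \<open>v\<^sub>i\<close>, normalized differences of
  unit vectors at the nodes that subdivide an edge or a pair, and the vectors of \<open>K4_relation\<close> at the
  nodes \<open>v\<^sub>1\<^sub>i\<close>.
\<close>

definition coordinate :: "nat \<Rightarrow> node \<Rightarrow> real" where
  "coordinate k v = (case v of
     N i \<Rightarrow> of_bool (k = i)
   | M i j \<Rightarrow> if i = 1 \<and> 3 \<le> j then (if k = 1 \<or> k = 2 then 1 else A j k) / apex_norm j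
              else (of_bool (k = i) - of_bool (k = j)) / sqrt 2)"

lemma apex_norm_square: "(apex_norm i)\<^sup>2 = 2 + (\<Sum>k\<in>{3..r}. (A i k)\<^sup>2)"
  unfolding apex_norm_def by (simp add: sum_nonneg)

lemma apex_norm_pos: "0 < apex_norm i"
  unfolding apex_norm_def by (simp add: add_pos_nonneg sum_nonneg)

lemma sum_split_12: "(\<Sum>k\<in>{1..r}. g k) = g 1 + g 2 + (\<Sum>k\<in>{3..r}. g k :: real)"
proof -
  have "{1..r} = {1, 2} \<union> {3..r}" using r by auto
  then show ?thesis by (simp add: sum.union_disjoint)
qed

lemma coordinate_unit:
  assumes "u \<in> V"
  shows "(\<Sum>k\<in>{1..r}. (coordinate k u)\<^sup>2) = 1"
proof (cases u)
  case (N i)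
  then have "i \<in> {1..r}" using assms by (simp add: N_in_V)
  have "(\<Sum>k\<in>{1..r}. (coordinate k u)\<^sup>2) = (\<Sum>k\<in>{1..r}. if k = i then 1 else 0)"
    by (intro sum.cong refl) (simp add: coordinate_def N)
  then show ?thesis using \<open>i \<in> {1..r}\<close> by simp
next
  case (M i j)
  then have ij: "1 \<le> i" "i < j" "j \<le> r" using assms by (simp_all add: M_in_V)
  show ?thesis
  proof (cases "i = 1 \<and> 3 \<le> j")
    case True
    have "(\<Sum>k\<in>{1..r}. (coordinate k u)\<^sup>2) =
      (\<Sum>k\<in>{1..r}. (if k = 1 \<or> k = 2 then 1 else A j k)\<^sup>2 / (apex_norm j)\<^sup>2)"
      using True by (intro sum.cong refl) (simp add: coordinate_def M power_divide)
    also have "\<dots> = (\<Sum>k\<in>{1..r}. (if k = 1 \<or> k = 2 then 1 else A j k)\<^sup>2) / (apex_norm j)\<^sup>2"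
      by (simp add: sum_divide_distrib)
    also have "(\<Sum>k\<in>{1..r}. (if k = 1 \<or> k = 2 then 1 else A j k)\<^sup>2) = (apex_norm j)\<^sup>2"
    proof -
      have "(\<Sum>k\<in>{3..r}. (if k = 1 \<or> k = 2 then 1 else A j k)\<^sup>2) = (\<Sum>k\<in>{3..r}. (A j k)\<^sup>2)"
        by (intro sum.cong refl) auto
      then show ?thesis unfolding sum_split_12 apex_norm_square by simp
    qed
    finally show ?thesis using apex_norm_pos[of j] by simp
  next
    case False
    have "(\<Sum>k\<in>{1..r}. (coordinate k u)\<^sup>2) =
      (\<Sum>k\<in>{1..r}. (if k = i then 1 / 2 else 0) + (if k = j then 1 / 2 else 0))"
      using False ij by (intro sum.cong refl) (auto simp: coordinate_def M power_divide)
    then show ?thesis using ij by (simp add: sum.distrib)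
  qed
qed

lemma path_relation_coordinate:
  assumes "\<not> (a = 1 \<and> 3 \<le> b)"
  shows "path_relation a b (coordinate k) = 0"
proof -
  have "coordinate k (M a b) = (of_bool (k = a) - of_bool (k = b)) / sqrt 2"
    using assms by (auto simp: coordinate_def)
  moreover have "coordinate k (N i) = of_bool (k = i)" for i by (simp add: coordinate_def)
  ultimately show ?thesis by (simp add: path_relation_def)
qed

lemma K4_relation_coordinate:
  assumes "i \<in> {3..r}" and "k \<in> {1..r}"
  shows "K4_relation i (coordinate k) = 0"
proof -
  have "(\<Sum>l\<in>{3..r}. A i l * coordinate k (N l)) = (\<Sum>l\<in>{3..r}. if l = k then A i k else 0)"
    by (intro sum.cong refl) (auto simp: coordinate_def)
  also have "\<dots> = (if 3 \<le> k then A i k else 0)" using assms(2) by simp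
  finally have sum: "(\<Sum>l\<in>{3..r}. A i l * coordinate k (N l)) = (if 3 \<le> k then A i k else 0)" .
  have "apex_norm i * coordinate k (M 1 i) = (if k = 1 \<or> k = 2 then 1 else A i k)"
    using assms(1) apex_norm_pos[of i] by (simp add: coordinate_def)
  then show ?thesis
    using assms(2) unfolding K4_relation_def sum by (auto simp: coordinate_def)
qed

lemma Q_coordinate: "k \<in> {1..r} \<Longrightarrow> Q (coordinate k) = 0"
proof -
  assume k: "k \<in> {1..r}"
  have "(\<Sum>(a, b)\<in>index_pairs r. path_weight a b * (path_relation a b (coordinate k))\<^sup>2) = 0"
    by (rule sum.neutral) (auto simp: index_pairs_def path_relation_coordinate)
  then show ?thesis
    using K4_relation_coordinate[OF _ k] unfolding Q_def by (simp add: path_relation_coordinate)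
qed

lemma Q_cong:
  assumes "\<And>v. v \<in> V \<Longrightarrow> y v = z v"
  shows "Q y = Q z"
proof -
  have N: "y (N i) = z (N i)" if "1 \<le> i" "i \<le> r" for i using assms that by (simp add: N_in_V)
  have M: "y (M i j) = z (M i j)" if "1 \<le> i" "i < j" "j \<le> r" for i j using assms that by (simp add: M_in_V)
  have K4: "K4_relation i y = K4_relation i z" if "i \<in> {3..r}" for i
  proof -
    have "(\<Sum>k\<in>{3..r}. A i k * y (N k)) = (\<Sum>k\<in>{3..r}. A i k * z (N k))"
      by (intro sum.cong refl) (simp add: N)
    then show ?thesis using that r N[of 1] N[of 2] M[of 1 i] by (simp add: K4_relation_def)
  qed
  have path: "path_relation a b y = path_relation a b z" if "1 \<le> a" "a < b" "b \<le> r" for a b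
    using that N[of a] N[of b] M[of a b] by (simp add: path_relation_def)
  have 1: "(\<Sum>i\<in>{3..r}. \<Sum>j\<in>{3..r}. K4_relation i y * T i j * K4_relation j y) =
    (\<Sum>i\<in>{3..r}. \<Sum>j\<in>{3..r}. K4_relation i z * T i j * K4_relation j z)"
    by (intro sum.cong refl) (simp only: K4)
  have 2: "path_relation 1 2 y = path_relation 1 2 z" using r by (intro path) auto
  have 3: "(\<Sum>k\<in>{3..r}. (\<Sum>i\<in>{3..r}. B i k) * (path_relation 2 k y)\<^sup>2) =
    (\<Sum>k\<in>{3..r}. (\<Sum>i\<in>{3..r}. B i k) * (path_relation 2 k z)\<^sup>2)"
    by (rule sum.cong[OF refl]) (simp add: path)
  have 4: "(\<Sum>(a, b)\<in>index_pairs r. path_weight a b * (path_relation a b y)\<^sup>2) =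
    (\<Sum>(a, b)\<in>index_pairs r. path_weight a b * (path_relation a b z)\<^sup>2)"
    by (rule sum.cong[OF refl]) (auto simp: index_pairs_def path)
  show ?thesis unfolding Q_def 1 2 3 4 ..
qed

lemma coordinates_feasible:
  defines "p \<equiv> \<lambda>k v. coordinate (Suc k) (inv_into V f v)"
  shows "elliptope n (gram r p)" and "k < r \<Longrightarrow> Q (\<lambda>v. p k (f v)) = 0"
proof -
  have inj: "inj_on f V" using f by (rule bij_betw_imp_inj_on)
  have "gram r p i i = 1" if "i < n" for i
  proof -
    have "i \<in> f ` V" using that f by (simp add: bij_betw_def)
    then have "inv_into V f i \<in> V" by (rule inv_into_into)
    then have "(\<Sum>k\<in>{1..r}. (coordinate k (inv_into V f i))\<^sup>2) = 1" by (rule coordinate_unit)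
    moreover have "gram r p i i = (\<Sum>k\<in>Suc ` {..<r}. (coordinate k (inv_into V f i))\<^sup>2)"
      by (simp add: gram_def p_def sum.reindex power2_eq_square)
    moreover have "Suc ` {..<r} = {1..r}"
      by (simp add: lessThan_atLeast0 image_Suc_atLeastLessThan atLeastLessThanSuc_atLeastAtMost)
    ultimately show ?thesis by simp
  qed
  then show "elliptope n (gram r p)" by (simp add: elliptope_def psd_on_gram)
  show "Q (\<lambda>v. p k (f v)) = 0" if "k < r"
  proof -
    have "Q (\<lambda>v. p k (f v)) = Q (coordinate (Suc k))"
      by (rule Q_cong) (simp add: p_def inv_into_f_f[OF inj])
    then show ?thesis using that by (simp add: Q_coordinate)
  qed
qed

text \<open>
  The \<open>r (r + 1) / 2\<close> conditions of unit length determine the Gram matrix of the vectors of \<open>v\<^sub>1, \<dots>, v\<^sub>r\<close>.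
  The path relation at \<open>v\<^sub>a\<^sub>b\<close> turns the unit length of \<open>v\<^sub>a\<^sub>b\<close> into \<open>\<langle>v\<^sub>a, v\<^sub>b\<rangle> = 0\<close>. This leaves the products
  \<open>x\<^sub>k = \<langle>v\<^sub>1, v\<^sub>k\<rangle>\<close> with \<open>k \<ge> 3\<close>, for which the unit lengths of the nodes \<open>v\<^sub>1\<^sub>i\<close> give \<open>A x = 0\<close>.
\<close>

lemma zero_Q_orthonormal:
  assumes ell: "elliptope n (gram m g)" and zero: "\<And>k. k < m \<Longrightarrow> Q (\<lambda>v. g k (f v)) = 0"
    and ab: "a \<in> {1..r}" "b \<in> {1..r}"
  shows "gram m g (f (N a)) (f (N b)) = (if a = b then 1 else 0)"
proof -
  define z where "z = (\<lambda>k v. g k (f v))"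
  define ip where "ip = gram m z"
  have ip: "gram m g (f u) (f v) = ip u v" for u v by (simp add: ip_def gram_def z_def)
  have ip_sym: "ip u v = ip v u" for u v unfolding ip_def by (rule gram_sym)
  have unit: "ip u u = 1" if "u \<in> V" for u
    using ell bij_betwE[OF f] that by (simp add: elliptope_def ip[symmetric])
  have zero': "Q (z k) = 0" if "k < m" for k using zero[OF that] by (simp add: z_def)
  have path: "ip (N a) (N b) = 0"
    if rel: "\<And>k. k < m \<Longrightarrow> path_relation a b (z k) = 0" and V: "M a b \<in> V" for a b
  proof -
    have "2 * ip (M a b) (M a b) = (\<Sum>k<m. (sqrt 2 * z k (M a b))\<^sup>2)"
      unfolding ip_def gram_def sum_distrib_left
      by (rule sum.cong[OF refl]) (simp add: power_mult_distrib, simp add: power2_eq_square)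
    also have "\<dots> = (\<Sum>k<m. (z k (N a) - z k (N b))\<^sup>2)"
    proof (rule sum.cong[OF refl])
      fix k assume "k \<in> {..<m}"
      then have "sqrt 2 * z k (M a b) = z k (N a) - z k (N b)"
        using rel[of k] by (simp add: path_relation_def)
      then show "(sqrt 2 * z k (M a b))\<^sup>2 = (z k (N a) - z k (N b))\<^sup>2" by simp
    qed
    also have "\<dots> = ip (N a) (N a) + ip (N b) (N b) - 2 * ip (N a) (N b)"
      unfolding ip_def gram_def sum_distrib_left sum.distrib[symmetric] sum_subtractf[symmetric]
      by (rule sum.cong[OF refl]) (simp add: power2_eq_square algebra_simps)
    finally show ?thesis using unit[OF V] unit[of "N a"] unit[of "N b"] V by (simp add: N_in_V M_in_V)
  qed
  have ip12: "ip (N 1) (N 2) = 0"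
    by (rule path) (use r Q_eq_0_imp(2)[OF zero'] in \<open>auto simp: M_in_V\<close>)
  have ip2: "ip (N 2) (N k) = 0" if "k \<in> {3..r}" for k
    by (rule path) (use that Q_eq_0_imp(3)[OF zero'] in \<open>auto simp: M_in_V\<close>)
  have less: "ip (N k) (N l) = 0" if "(k, l) \<in> index_pairs r" for k l
    by (rule path) (use that Q_eq_0_imp(4)[OF zero'] in \<open>auto simp: M_in_V index_pairs_def\<close>)
  have ipkl: "ip (N k) (N l) = (if k = l then 1 else 0)" if "k \<in> {3..r}" "l \<in> {3..r}" for k l
    using that less[of k l] less[of l k] ip_sym[of "N k" "N l"] unit[of "N k"]
    by (cases k l rule: linorder_cases) (auto simp: index_pairs_def N_in_V)
  have ip1: "\<forall>k\<in>{3..r}. ip (N 1) (N k) = 0"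
  proof (rule A_injective)
    fix i assume i: "i \<in> {3..r}"
    define S where "S = (\<lambda>k. \<Sum>l\<in>{3..r}. A i l * z k (N l))"
    have cross: "(\<Sum>k<m. z k u * S k) = (\<Sum>l\<in>{3..r}. A i l * ip u (N l))" for u
    proof -
      have "(\<Sum>k<m. z k u * S k) = (\<Sum>k<m. \<Sum>l\<in>{3..r}. A i l * (z k u * z k (N l)))"
        by (simp add: S_def sum_distrib_left mult_ac)
      also have "\<dots> = (\<Sum>l\<in>{3..r}. \<Sum>k<m. A i l * (z k u * z k (N l)))" by (rule sum.swap)
      finally show ?thesis by (simp add: ip_def gram_def sum_distrib_left)
    qed
    have SS: "(\<Sum>k<m. (S k)\<^sup>2) = (\<Sum>l\<in>{3..r}. (A i l)\<^sup>2)"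
    proof -
      have "(\<Sum>k<m. (S k)\<^sup>2) = (\<Sum>k<m. (\<Sum>l\<in>{3..r}. z k (N l) * A i l)\<^sup>2)"
        by (simp add: S_def mult.commute)
      also have "\<dots> = (\<Sum>l\<in>{3..r}. \<Sum>l'\<in>{3..r}. A i l * gram m (\<lambda>k l. z k (N l)) l l' * A i l')"
        by (rule form_gram[symmetric])
      also have "\<dots> = (\<Sum>l\<in>{3..r}. \<Sum>l'\<in>{3..r}. if l = l' then (A i l)\<^sup>2 else 0)"
      proof (intro sum.cong refl)
        fix l l' assume "l \<in> {3..r}" "l' \<in> {3..r}"
        then have "gram m (\<lambda>k l. z k (N l)) l l' = (if l = l' then 1 else 0)"
          using ipkl[of l l'] by (simp add: ip_def gram_def)
        then show "A i l * gram m (\<lambda>k l. z k (N l)) l l' * A i l' = (if l = l' then (A i l)\<^sup>2 else 0)"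
          by (simp add: power2_eq_square)
      qed
      finally show ?thesis by simp
    qed
    have "(apex_norm i)\<^sup>2 * ip (M 1 i) (M 1 i) = (\<Sum>k<m. (apex_norm i * z k (M 1 i))\<^sup>2)"
      unfolding ip_def gram_def sum_distrib_left
      by (rule sum.cong[OF refl]) (simp add: power2_eq_square mult_ac)
    also have "\<dots> = (\<Sum>k<m. (z k (N 1) + z k (N 2) + S k)\<^sup>2)"
    proof (rule sum.cong[OF refl])
      fix k assume "k \<in> {..<m}"
      then have "apex_norm i * z k (M 1 i) = z k (N 1) + z k (N 2) + S k"
        using Q_eq_0_imp(1)[OF zero' i, of k] by (simp add: K4_relation_def S_def)
      then show "(apex_norm i * z k (M 1 i))\<^sup>2 = (z k (N 1) + z k (N 2) + S k)\<^sup>2" by simp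
    qed
    also have "\<dots> = (\<Sum>k<m. z k (N 1) * z k (N 1) + z k (N 2) * z k (N 2) + (S k)\<^sup>2
        + 2 * (z k (N 1) * z k (N 2)) + 2 * (z k (N 1) * S k) + 2 * (z k (N 2) * S k))"
      by (intro sum.cong refl) (simp add: power2_eq_square algebra_simps)
    also have "\<dots> = ip (N 1) (N 1) + ip (N 2) (N 2) + (\<Sum>k<m. (S k)\<^sup>2) + 2 * ip (N 1) (N 2)
        + 2 * (\<Sum>k<m. z k (N 1) * S k) + 2 * (\<Sum>k<m. z k (N 2) * S k)"
      by (simp only: sum.distrib sum_distrib_left[symmetric] ip_def gram_def)
    also have "(\<Sum>k<m. z k (N 2) * S k) = 0" unfolding cross using ip2 by simp
    finally have "(apex_norm i)\<^sup>2 = 2 + (\<Sum>l\<in>{3..r}. (A i l)\<^sup>2) + 2 * (\<Sum>l\<in>{3..r}. A i l * ip (N 1) (N l))"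
      using unit[of "M 1 i"] unit[of "N 1"] unit[of "N 2"] i r ip12 by (simp add: SS cross N_in_V M_in_V)
    then show "(\<Sum>l\<in>{3..r}. A i l * ip (N 1) (N l)) = 0" unfolding apex_norm_square by simp
  qed
  have "ip (N a) (N b) = (if a = b then 1 else 0)"
  proof -
    consider "a = b" | "a = 1" "b = 2" | "a = 2" "b = 1" | "a = 1" "b \<in> {3..r}" | "b = 1" "a \<in> {3..r}"
      | "a = 2" "b \<in> {3..r}" | "b = 2" "a \<in> {3..r}" | "a \<in> {3..r}" "b \<in> {3..r}"
      using ab by force
    then show ?thesis
      using unit[of "N a"] ab ip12 ip1 ip2 ipkl ip_sym[of "N a" "N b"]
      by cases (auto simp: N_in_V)
  qed
  then show ?thesis by (simp add: ip)
qed

theorem weight_forcing_rank: "\<exists>w. \<forall>X. sdp_optimal n F w X \<longrightarrow> r \<le> vec_space.rank n X"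
proof -
  let ?q = "\<lambda>y. Q (\<lambda>v. y (f v))"
  let ?J = "f ` N ` {1..r}"
  have sub: "N ` {1..r} \<subseteq> V" by (auto simp: N_in_V)
  have inj: "inj_on f (N ` {1..r})"
    using bij_betw_imp_inj_on[OF f] sub by (rule inj_on_subset)
  have card: "card ?J = r" using inj by (simp add: card_image inj_on_def[of N])
  have "\<exists>w. \<forall>X. sdp_optimal n F w X \<longrightarrow> card ?J \<le> vec_space.rank n X"
  proof (rule edge_form_forces_rank)
    show "edge_form n F ?q" using node_form_Q by (simp add: node_form_def)
    show "0 \<le> ?q y" for y by (rule Q_nonneg)
    show "elliptope n (gram r (\<lambda>k v. coordinate (Suc k) (inv_into V f v)))"
      by (rule coordinates_feasible)
    show "Q (\<lambda>v. coordinate (Suc k) (inv_into V f (f v))) = 0" if "k < r" for k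
      using coordinates_feasible(2)[OF that] .
    show "?J \<subseteq> {..<n}" using bij_betwE[OF f] sub by fastforce
  next
    fix m g i j
    assume "elliptope n (gram m g)" "\<And>k. k < m \<Longrightarrow> Q (\<lambda>v. g k (f v)) = 0" "i \<in> ?J" "j \<in> ?J"
    moreover then obtain a b where ab: "i = f (N a)" "a \<in> {1..r}" "j = f (N b)" "b \<in> {1..r}" by blast
    moreover have "i = j \<longleftrightarrow> a = b" using ab inj by (auto dest: inj_onD)
    ultimately show "gram m g i j = (if i = j then 1 else 0)" using zero_Q_orthonormal by simp
  qed
  then show ?thesis unfolding card .
qed

text \<open>
  The upper bound is a matter of counting: there are \<open>r (r + 1) / 2\<close> nodes.
\<close>

lemma egd_eq: "egd n F = r"
  unfolding egd_def
proof (rule Least_equality)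
  have "\<exists>X. sdp_optimal n F w X \<and> vec_space.rank n X \<le> r" for w
  proof -
    obtain X s where X: "sdp_optimal n F w X" "vec_space.rank n X \<le> s" "s * (s + 1) div 2 \<le> n"
      using low_rank_optimum_exists by blast
    have "s \<le> r"
    proof (rule ccontr)
      assume "\<not> s \<le> r"
      then have "Suc r * (Suc r + 1) \<le> s * (s + 1)" by (intro mult_le_mono) auto
      then have "Suc r * (Suc r + 1) div 2 \<le> s * (s + 1) div 2" by (rule div_le_mono)
      moreover have "Suc r * (Suc r + 1) = r * (r + 1) + (r + 1) * 2" by simp
      then have "Suc r * (Suc r + 1) div 2 = r * (r + 1) div 2 + (r + 1)" by (simp only: div_mult_self1)
      ultimately show False using X(3) n_eq by linarith
    qed
    then show ?thesis using X by (intro exI[of _ X]) simp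
  qed
  then show "1 \<le> r \<and> (\<forall>w. \<exists>X. sdp_optimal n F w X \<and> vec_space.rank n X \<le> r)" using r by simp
next
  fix s assume s: "1 \<le> s \<and> (\<forall>w. \<exists>X. sdp_optimal n F w X \<and> vec_space.rank n X \<le> s)"
  obtain w where w: "\<forall>X. sdp_optimal n F w X \<longrightarrow> r \<le> vec_space.rank n X"
    using weight_forcing_rank by blast
  obtain X where "sdp_optimal n F w X" "vec_space.rank n X \<le> s" using s by blast
  then show "r \<le> s" using w by (meson order_trans)
qed

end

theorem theorem4p9:
  fixes r n :: nat and V :: "node set" and E :: "node set set" and f :: "node \<Rightarrow> nat"
  assumes "r \<ge> 3"
    and "(V, E) \<in> H_class r"
    and "bij_betw f V {0..<n}"
  shows "egd n ((\<lambda>e. f ` e) ` E) = r"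
proof -
  obtain c where "V = H_nodes r" "E = H_edges r c" "\<forall>(i, j) \<in> index_pairs r. c i j \<in> link_edges i j"
    using assms(2) by (auto simp: H_class_def)
  then interpret H_graph r n c f
    using assms by unfold_locales auto
  show ?thesis using egd_eq \<open>E = H_edges r c\<close> by simp
qed

end
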